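(* Let $\mathcal H$ be a complex Hilbert space and let $A=N+K$, where $N$ is a bounded normal operator on $\mathcal H$ and $K$ is a compact operator on $\mathcal H$. Suppose $W(A)\subset\overline{\mathbb D}$, and let $\Gamma$ be a relatively open subset of $\mathbb T$ such that $\Gamma\cap\sigma_{ess}(A)=\emptyset$. If every connected component $\Gamma_j$ of $\Gamma$ contains a limit point of the set $\Gamma_j\cap\overline{W(A)}$, then $\Gamma\subset W(A)$.
   Context: All operators are bounded linear operators on a complex Hilbert space $\mathcal H$. The numerical range of $A$ is $W(A)=\{\langle Ax,x\rangle : x\in\mathcal H,\ \|x\|=1\}$, and $\overline{W(A)}$ is its closure in $\mathbb C$. $\mathbb D=\{z\in\mathbb C: |z|<1\}$ is the open unit disk, $\overline{\mathbb D}$ the closed unit disk, and $\mathbb T=\partial\mathbb D$ the unit circle. The essential spectrum $\sigma_{ess}(A)$ is the set of $\lambda\in\mathbb C$ such that $A-\lambda I$ is not Fredholm (equivalently, the spectrum of the class of $A$ in the Calkin algebra). *)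

theory Defs
  imports "HOL-Analysis.Analysis"
begin

(* Complex Hilbert spaces, on top of the real inner product Re <x,y>: positive definiteness,
   the norm and completeness are inherited from real_inner and complete_space.
   The complex inner product is linear in its first argument. *)
class chilbert_space = real_inner + complete_space +
  fixes scaleC :: "complex \<Rightarrow> 'a \<Rightarrow> 'a" (infixr "*\<^sub>C" 75)
    and cinner :: "'a \<Rightarrow> 'a \<Rightarrow> complex"
  assumes scaleC_add_right: "c *\<^sub>C (x + y) = c *\<^sub>C x + c *\<^sub>C y"
    and scaleC_add_left: "(c + d) *\<^sub>C x = c *\<^sub>C x + d *\<^sub>C x"
    and scaleC_scaleC: "c *\<^sub>C d *\<^sub>C x = (c * d) *\<^sub>C x"
    and scaleR_eq_scaleC: "scaleR r x = complex_of_real r *\<^sub>C x"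
    and cinner_add_left: "cinner (x + y) z = cinner x z + cinner y z"
    and cinner_scaleC_left: "cinner (c *\<^sub>C x) y = c * cinner x y"
    and cinner_commute: "cinner x y = cnj (cinner y x)"
    and inner_eq_Re_cinner: "inner x y = Re (cinner x y)"
begin

subclass banach ..

end

lemma scaleC_one: "1 *\<^sub>C x = (x :: 'a::chilbert_space)"
  using scaleR_eq_scaleC[of 1 x] by simp

lemma cinner_self: "cinner x x = complex_of_real ((norm x)\<^sup>2)"
  for x :: "'a::chilbert_space"
proof (rule complex_eqI)
  show "Re (cinner x x) = Re (complex_of_real ((norm x)\<^sup>2))"
    by (simp flip: inner_eq_Re_cinner add: power2_norm_eq_inner)
  have "Im (cinner x x) = - Im (cinner x x)"
    by (subst cinner_commute) simp
  then show "Im (cinner x x) = Im (complex_of_real ((norm x)\<^sup>2))"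
    by simp
qed

instantiation complex :: chilbert_space
begin

definition scaleC_complex :: "complex \<Rightarrow> complex \<Rightarrow> complex"
  where "scaleC_complex c x = c * x"

definition cinner_complex :: "complex \<Rightarrow> complex \<Rightarrow> complex"
  where "cinner_complex x y = x * cnj y"

instance
  by standard
    (auto simp: scaleC_complex_def cinner_complex_def inner_complex_def algebra_simps
      scaleR_conv_of_real)

end

global_interpretation complex_vector:
  vector_space "scaleC :: complex \<Rightarrow> 'a \<Rightarrow> 'a::chilbert_space"
  defines cspan = complex_vector.span
  by standard (simp_all add: scaleC_add_right scaleC_add_left scaleC_scaleC scaleC_one)

definition bounded_clinear :: "('a::chilbert_space \<Rightarrow> 'b::chilbert_space) \<Rightarrow> bool"
  where "bounded_clinear A \<longleftrightarrow> bounded_linear A \<and> (\<forall>c x. A (c *\<^sub>C x) = c *\<^sub>C A x)"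

definition is_cadjoint :: "('a::chilbert_space \<Rightarrow> 'a) \<Rightarrow> ('a \<Rightarrow> 'a) \<Rightarrow> bool"
  where "is_cadjoint A B \<longleftrightarrow> (\<forall>x y. cinner (A x) y = cinner x (B y))"

(* An adjoint is unique, and exists for every bounded operator by Riesz representation. *)
lemma is_cadjoint_unique:
  assumes "is_cadjoint A B" "is_cadjoint A C"
  shows "B = C"
proof
  fix y
  have "cinner x (B y) = cinner x (C y)" for x
    using assms unfolding is_cadjoint_def by metis
  then have "inner x (B y) = inner x (C y)" for x
    by (simp add: inner_eq_Re_cinner)
  then show "B y = C y"
    using vector_eq_ldot by blast
qed

definition normal_operator :: "('a::chilbert_space \<Rightarrow> 'a) \<Rightarrow> bool"
  where "normal_operator N \<longleftrightarrow>
    bounded_clinear N \<and> (\<exists>M. bounded_clinear M \<and> is_cadjoint N M \<and> N \<circ> M = M \<circ> N)"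

definition compact_operator :: "('a::chilbert_space \<Rightarrow> 'b::chilbert_space) \<Rightarrow> bool"
  where "compact_operator K \<longleftrightarrow> bounded_clinear K \<and> compact (closure (K ` cball 0 1))"

(* The last conjunct says that the range has finite codimension. *)
definition fredholm_operator :: "('a::chilbert_space \<Rightarrow> 'b::chilbert_space) \<Rightarrow> bool"
  where "fredholm_operator A \<longleftrightarrow>
    bounded_clinear A \<and>
    (\<exists>B. finite B \<and> {x. A x = 0} \<subseteq> cspan B) \<and>
    closed (range A) \<and>
    (\<exists>B. finite B \<and> cspan (range A \<union> B) = UNIV)"

definition essential_spectrum :: "('a::chilbert_space \<Rightarrow> 'a) \<Rightarrow> complex set"
  where "essential_spectrum A = {l. \<not> fredholm_operator (\<lambda>x. A x - l *\<^sub>C x)}"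

definition numerical_range :: "('a::chilbert_space \<Rightarrow> 'a) \<Rightarrow> complex set"
  where "numerical_range A = {cinner (A x) x | x. norm x = 1}"

end

theory Submission
  imports Defs "HOL-Complex_Analysis.Conformal_Mappings" "Jordan_Normal_Form.Determinant"
begin

text \<open>
  For \<open>z \<noteq> 0\<close> consider the operator pencil \<open>T(z) = 1 - (A / z + z A\<^sup>*) / 2\<close>. On the unit circle
  it is self-adjoint, with \<open>\<langle>T(z) x, x\<rangle> = \<parallel>x\<parallel>\<^sup>2 - Re (cnj z \<langle>A x, x\<rangle>)\<close>. Since the numerical range lies in
  the closed disk, \<open>T(z)\<close> is positive there, and \<open>z\<close> belongs to the numerical range exactly
  when \<open>T(z)\<close> has a nontrivial kernel. The theorem says that this kernel cannot vanish
  anywhere on a component of \<open>\<Gamma>\<close> once it is nontrivial on a set with a limit point there: an identity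
  theorem for the analytic family \<open>T\<close>, in the spirit of the analytic Fredholm alternative.

  Two facts carry the proof. The first is that \<open>T(z)\<close> is Fredholm for \<open>z \<in> \<Gamma>\<close>, in the quantitative form
  that \<open>T(z)\<close> plus a finite sum \<open>P\<close> of positive rank-one operators is coercive
  (\<open>coercive_modulo_finite_rank\<close>). Otherwise there is a weakly null net of unit vectors \<open>x\<^sub>i\<close> with
  \<open>\<langle>T(z) x\<^sub>i, x\<^sub>i\<rangle> \<rightarrow> 0\<close>. Such a net does not see the compact part \<open>K\<close>. Write \<open>cnj z N = X + i Y\<close> with
  commuting self-adjoint \<open>X\<close>, \<open>Y\<close>. Positivity of \<open>T(z)\<close> gives \<open>X x\<^sub>i - x\<^sub>i \<rightarrow> 0\<close>. On every weakly null net
  \<open>y\<^sub>i\<close> with \<open>X y\<^sub>i - y\<^sub>i \<rightarrow> 0\<close> the real part of the form of \<open>cnj z N\<close> already exhausts its bound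
  \<open>\<parallel>y\<^sub>i\<parallel>\<^sup>2\<close>, so \<open>\<langle>Y y\<^sub>i, y\<^sub>i\<rangle> \<rightarrow> 0\<close>. As \<open>Y\<close> commutes with \<open>X\<close>, the nets \<open>x\<^sub>i \<plusminus> Y x\<^sub>i\<close> are of this kind, and
  subtracting the two limits yields \<open>Y x\<^sub>i \<rightarrow> 0\<close>. Hence \<open>A x\<^sub>i - z x\<^sub>i \<rightarrow> 0\<close>, which is impossible when \<open>A - z\<close>
  is Fredholm.

  The second fact is the reduction to finite matrices. Near a point of \<open>\<Gamma>\<close>, for complex \<open>z\<close>, the operator
  \<open>B(z) = T(z) + P\<close> with \<open>P x = \<Sum>\<^sub>j \<langle>x, e\<^sub>j\<rangle> e\<^sub>j\<close> stays coercive, hence invertible by Lax--Milgram. Then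
  \<open>T(z) x = 0\<close> means \<open>x = \<Sum>\<^sub>j \<langle>x, e\<^sub>j\<rangle> B(z)\<^sup>-\<^sup>1 e\<^sub>j\<close>, so that \<open>T(z)\<close> has a kernel iff the matrix with entries
  \<open>\<langle>B(z)\<^sup>-\<^sup>1 e\<^sub>j, e\<^sub>i\<rangle>\<close> has the eigenvalue \<open>1\<close>. The corresponding determinant is holomorphic in
  \<open>z\<close>, and the identity theorem applies (\<open>pencil_kernel_continuation\<close>). The same reduction shows that points
  of \<open>\<Gamma>\<close> in the closure of the numerical range belong to the numerical range. Consequently
  the limit points of the numerical range in a component of \<open>\<Gamma>\<close> form a nonempty subset that is both open and
  closed in the component.
\<close>

section \<open>The complex inner product and bounded operators\<close>

lemma cinner_add_right: "cinner x (y + z) = cinner x y + cinner x (z::'a::chilbert_space)"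
  by (metis cinner_add_left cinner_commute complex_cnj_add)

lemma cinner_scaleC_right: "cinner x (c *\<^sub>C y) = cnj c * cinner x (y::'a::chilbert_space)"
  by (metis cinner_scaleC_left cinner_commute complex_cnj_mult)

lemma cinner_scaleR_left: "cinner (r *\<^sub>R x) y = r *\<^sub>R cinner x (y::'a::chilbert_space)"
  by (simp add: scaleR_eq_scaleC[of r x] cinner_scaleC_left scaleR_conv_of_real)

lemma cinner_scaleR_right: "cinner x (r *\<^sub>R y) = r *\<^sub>R cinner x (y::'a::chilbert_space)"
  by (simp add: scaleR_eq_scaleC[of r y] cinner_scaleC_right scaleR_conv_of_real)

lemma norm_scaleC: "norm (c *\<^sub>C x) = cmod c * norm (x::'a::chilbert_space)"
proof -
  have "complex_of_real ((norm (c *\<^sub>C x))\<^sup>2) = (c * cnj c) * cinner x x"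
    by (simp only: cinner_self [symmetric] cinner_scaleC_left cinner_scaleC_right mult_ac)
  also have "\<dots> = complex_of_real ((cmod c * norm x)\<^sup>2)"
    by (simp only: cinner_self complex_norm_square [symmetric] power_mult_distrib of_real_mult)
  finally have "(norm (c *\<^sub>C x))\<^sup>2 = (cmod c * norm x)\<^sup>2"
    using of_real_eq_iff by blast
  then show ?thesis
    by (simp add: power2_eq_iff_nonneg)
qed

lemma cinner_Cauchy_Schwarz: "cmod (cinner x y) \<le> norm x * norm (y::'a::chilbert_space)"
proof (cases "cinner x y = 0")
  case False
  define c where "c = cnj (cinner x y) / cmod (cinner x y)"
  have c: "cmod c = 1" "c * cinner x y = cmod (cinner x y)"
    using False by (auto simp: c_def norm_divide mult.commute[of "cnj _"] simp flip: complex_norm_square)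
       (simp add: power2_eq_square)
  have "cmod (cinner x y) = inner (c *\<^sub>C x) y"
    by (simp add: inner_eq_Re_cinner cinner_scaleC_left c)
  also have "\<dots> \<le> norm (c *\<^sub>C x) * norm y"
    by (rule norm_cauchy_schwarz)
  finally show ?thesis
    by (simp add: norm_scaleC c)
qed simp

lemma bounded_bilinear_cinner: "bounded_bilinear (cinner :: 'a::chilbert_space \<Rightarrow> 'a \<Rightarrow> complex)"
  by unfold_locales
    (auto simp: cinner_add_left cinner_add_right cinner_scaleR_left cinner_scaleR_right
      intro!: exI[of _ 1] cinner_Cauchy_Schwarz)

lemma bounded_bilinear_scaleC: "bounded_bilinear (scaleC :: complex \<Rightarrow> 'a::chilbert_space \<Rightarrow> 'a)"
  by unfold_locales
    (auto simp: scaleC_add_left scaleC_add_right scaleR_eq_scaleC scaleC_scaleC norm_scaleC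
      scaleR_conv_of_real mult.commute scaleC_complex_def intro!: exI[of _ 1])

interpretation cinner: bounded_bilinear "cinner :: 'a::chilbert_space \<Rightarrow> 'a \<Rightarrow> complex"
  by (rule bounded_bilinear_cinner)

interpretation scaleC: bounded_bilinear "scaleC :: complex \<Rightarrow> 'a::chilbert_space \<Rightarrow> 'a"
  by (rule bounded_bilinear_scaleC)

lemmas cinner_simps = cinner.add_left cinner.add_right cinner.diff_left cinner.diff_right
  cinner.minus_left cinner.minus_right cinner_scaleC_left cinner_scaleC_right
  cinner.sum_left cinner.sum_right

lemma bounded_clinear_bounded_linear: "bounded_clinear A \<Longrightarrow> bounded_linear A"
  and bounded_clinear_scaleC: "bounded_clinear A \<Longrightarrow> A (c *\<^sub>C x) = c *\<^sub>C A x"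
  by (simp_all add: bounded_clinear_def)

lemma bounded_clinear_add: "bounded_clinear A \<Longrightarrow> A (x + y) = A x + A y"
  and bounded_clinear_diff: "bounded_clinear A \<Longrightarrow> A (x - y) = A x - A y"
  and bounded_clinear_zero: "bounded_clinear A \<Longrightarrow> A 0 = 0"
  by (simp_all add: bounded_clinear_bounded_linear linear_simps)

lemma bounded_clinear_id: "bounded_clinear (\<lambda>x. x)"
  by (simp add: bounded_clinear_def bounded_linear_ident)

lemma bounded_clinear_plus:
  "bounded_clinear A \<Longrightarrow> bounded_clinear B \<Longrightarrow> bounded_clinear (\<lambda>x. A x + B x)"
  by (simp add: bounded_clinear_def bounded_linear_add scaleC_add_right)

lemma bounded_clinear_minus:
  "bounded_clinear A \<Longrightarrow> bounded_clinear B \<Longrightarrow> bounded_clinear (\<lambda>x. A x - B x)"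
  by (simp add: bounded_clinear_def bounded_linear_sub scaleC.diff_right)

lemma bounded_clinear_cmult: "bounded_clinear A \<Longrightarrow> bounded_clinear (\<lambda>x. c *\<^sub>C A x)"
  using bounded_linear_compose[OF scaleC.bounded_linear_right[of c], of A]
  by (simp add: bounded_clinear_def scaleC_scaleC mult.commute)

lemma bounded_clinear_rank_one: "bounded_clinear (\<lambda>x. cinner x e *\<^sub>C f)"
  using bounded_linear_compose[OF scaleC.bounded_linear_left[of f] cinner.bounded_linear_left[of e]]
  by (simp add: bounded_clinear_def cinner_scaleC_left scaleC_scaleC)

lemma bounded_clinear_sum:
  "(\<And>i. i \<in> I \<Longrightarrow> bounded_clinear (A i)) \<Longrightarrow> bounded_clinear (\<lambda>x. \<Sum>i\<in>I. A i x)"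
  by (auto simp: bounded_clinear_def scaleC.sum_right intro!: bounded_linear_sum sum.cong)

lemmas bounded_clinear_intros = bounded_clinear_id bounded_clinear_plus bounded_clinear_minus
  bounded_clinear_cmult bounded_clinear_rank_one bounded_clinear_sum

lemma bounded_clinear_bound:
  assumes "bounded_clinear A" obtains C where "C > 0" "\<And>x. norm (A x) \<le> C * norm x"
  using bounded_linear.pos_bounded[OF bounded_clinear_bounded_linear[OF assms]]
  by (metis mult.commute)

lemma is_cadjoint_commute: "is_cadjoint A B \<Longrightarrow> is_cadjoint B A"
  unfolding is_cadjoint_def by (metis cinner_commute)

text \<open>The vector that represents \<open>f\<close> minimizes \<open>\<parallel>x\<parallel>\<^sup>2 - 2 f(x)\<close>; minimizing sequences are
  Cauchy by the parallelogram law.\<close>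
theorem Riesz_representation:
  fixes f :: "'a::{real_inner, complete_space} \<Rightarrow> real"
  assumes "bounded_linear f"
  shows "\<exists>u. \<forall>x. f x = inner x u"
proof -
  interpret f: bounded_linear f by fact
  obtain C where C: "C > 0" "\<And>x. norm (f x) \<le> norm x * C"
    using f.pos_bounded by blast
  define J where "J x = (norm x)\<^sup>2 - 2 * f x" for x
  have J_bound: "- C\<^sup>2 \<le> J x" for x
  proof -
    have "f x \<le> norm x * C" using C(2)[of x] by simp
    moreover have "0 \<le> (norm x - C)\<^sup>2" by simp
    ultimately show ?thesis by (simp add: J_def power2_eq_square algebra_simps)
  qed
  define m where "m = (INF x. J x)"
  have bdd: "bdd_below (range J)" using J_bound by (auto intro!: bdd_belowI[of _ "- C\<^sup>2"])
  have m_le: "m \<le> J x" for x unfolding m_def using bdd by (rule cINF_lower) simp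
  have "\<exists>x. J x < m + 1 / Suc n" for n
    using cINF_less_iff[OF _ bdd, of "m + 1 / Suc n"] by (auto simp: m_def)
  then obtain x where x: "\<And>n. J (x n) < m + 1 / Suc n" by metis
  have J_mid: "(norm (a - b))\<^sup>2 \<le> 2 * J a + 2 * J b - 4 * m" for a b
  proof -
    have "(norm ((1/2) *\<^sub>R (a + b)))\<^sup>2 = (norm (a + b))\<^sup>2 / 4"
      unfolding norm_scaleR power_mult_distrib by (simp add: power_divide)
    then have "4 * J ((1/2) *\<^sub>R (a + b)) = (norm (a + b))\<^sup>2 - 4 * (f a + f b)"
      unfolding J_def f.scaleR f.add real_scaleR_def by (simp only:) (simp add: field_simps)
    moreover have "(norm (a + b))\<^sup>2 + (norm (a - b))\<^sup>2 = 2 * (norm a)\<^sup>2 + 2 * (norm b)\<^sup>2"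
      by (simp add: power2_norm_eq_inner inner_simps inner_commute)
    ultimately have "(norm (a - b))\<^sup>2 = 2 * J a + 2 * J b - 4 * J ((1/2) *\<^sub>R (a + b))"
      by (simp add: J_def)
    then show ?thesis using m_le[of "(1/2) *\<^sub>R (a + b)"] by simp
  qed
  have "Cauchy x"
  proof (rule metric_CauchyI)
    fix e :: real assume "e > 0"
    obtain M :: nat where M: "4 / e\<^sup>2 < M" using reals_Archimedean2 by blast
    have "0 < 4 / e\<^sup>2" using \<open>e > 0\<close> by simp
    with M have "M > 0" using of_nat_0_less_iff less_trans by blast
    have "dist (x p) (x n) < e" if "p \<ge> M" "n \<ge> M" for p n
    proof -
      have "1 / real (Suc k) < e\<^sup>2 / 4" if "k \<ge> M" for k
      proof -
        have "1 / real (Suc k) < 1 / M" using that \<open>M > 0\<close> by (simp add: frac_less2)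
        also have "\<dots> < e\<^sup>2 / 4" using M \<open>e > 0\<close> \<open>M > 0\<close> by (simp add: field_simps)
        finally show ?thesis .
      qed
      from this[OF that(1)] this[OF that(2)]
      have "(norm (x p - x n))\<^sup>2 < e\<^sup>2"
        using J_mid[of "x p" "x n"] x[of p] x[of n] by simp
      then show ?thesis
        using \<open>e > 0\<close> by (simp add: dist_norm power2_less_imp_less)
    qed
    then show "\<exists>M. \<forall>p\<ge>M. \<forall>n\<ge>M. dist (x p) (x n) < e" by blast
  qed
  then obtain u where u: "x \<longlonglongrightarrow> u" using Cauchy_convergent convergent_def by blast
  have "(\<lambda>n. J (x n)) \<longlonglongrightarrow> J u"
    unfolding J_def by (intro tendsto_intros f.tendsto u)
  moreover have "(\<lambda>n. m + 1 / Suc n) \<longlonglongrightarrow> m + 0"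
    by (intro tendsto_intros LIMSEQ_Suc lim_inverse_n')
  ultimately have "J u \<le> m"
    using LIMSEQ_le[of "\<lambda>n. J (x n)" "J u" "\<lambda>n. m + 1 / Suc n" m] x by (auto intro: less_imp_le)
  have "f y = inner y u" for y
  proof -
    define d where "d = inner y u - f y"
    have quad: "0 \<le> 2 * t * d + t\<^sup>2 * (norm y)\<^sup>2" for t
    proof -
      have "J (u + t *\<^sub>R y) = J u + 2 * t * d + t\<^sup>2 * (norm y)\<^sup>2"
        unfolding J_def d_def power2_norm_eq_inner
        by (simp add: f.add f.scaleR inner_simps inner_commute power2_eq_square algebra_simps)
      then show ?thesis using m_le[of "u + t *\<^sub>R y"] \<open>J u \<le> m\<close> by simp
    qed
    \<comment> \<open>a quadratic in \<open>t\<close> without constant term is nonnegative only if its linear term vanishes\<close>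
    define a where "a = (norm y)\<^sup>2 + 1"
    then have "(norm y)\<^sup>2 = a - 1" by simp
    then have "0 \<le> 2 * (- d / a) * d + (- d / a)\<^sup>2 * (a - 1)"
      using quad[of "- d / a"] by (simp only:)
    moreover have "a \<ge> 1" by (simp add: a_def)
    then have "(- d / a)\<^sup>2 * (a - 1) = d\<^sup>2 / a - (d / a)\<^sup>2" and "2 * (- d / a) * d = - 2 * (d\<^sup>2 / a)"
      by (simp_all add: field_simps power2_eq_square)
    ultimately have "0 \<le> - 2 * (d\<^sup>2 / a) + (d\<^sup>2 / a - (d / a)\<^sup>2)"
      by (simp only:)
    then have "d\<^sup>2 / a \<le> 0"
      using zero_le_power2[of "d / a"] by linarith
    then have "d = 0"
      using \<open>a \<ge> 1\<close> by (simp add: divide_le_0_iff)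
    then show ?thesis by (simp add: d_def)
  qed
  then show ?thesis by blast
qed

text \<open>Riesz representation produces the adjoint for the real inner product; applying its defining identity
  at \<open>\<i> x\<close> recovers the imaginary part of the complex one.\<close>
lemma cadjoint_exists:
  fixes A :: "'a::chilbert_space \<Rightarrow> 'a"
  assumes A: "bounded_clinear A"
  shows "\<exists>B. bounded_clinear B \<and> is_cadjoint A B"
proof -
  obtain C where C: "C > 0" "\<And>x. norm (A x) \<le> C * norm x"
    using bounded_clinear_bound[OF A] by blast
  have "bounded_linear (\<lambda>x. inner (A x) y)" for y
    by (rule bounded_linear_compose[OF bounded_linear_inner_left bounded_clinear_bounded_linear[OF A]])
  then have "\<forall>y. \<exists>u. \<forall>x. inner (A x) y = inner x u"
    using Riesz_representation by blast
  then obtain B where B: "\<And>x y. inner (A x) y = inner x (B y)"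
    by metis
  have adj: "cinner (A x) y = cinner x (B y)" for x y
  proof (rule complex_eqI)
    show "Re (cinner (A x) y) = Re (cinner x (B y))"
      using B[of x y] by (simp add: inner_eq_Re_cinner)
    show "Im (cinner (A x) y) = Im (cinner x (B y))"
      using B[of "\<i> *\<^sub>C x" y]
      by (simp add: inner_eq_Re_cinner bounded_clinear_scaleC[OF A] cinner_scaleC_left)
  qed
  have eqI: "u = v" if "\<And>x. cinner x u = cinner x v" for u v :: 'a
  proof -
    have "cinner (u - v) (u - v) = 0"
      using that[of "u - v"] by (simp add: cinner.diff_right)
    then show ?thesis by (simp add: cinner_self)
  qed
  have "bounded_linear B"
  proof (rule bounded_linear_intro)
    show "B (x + y) = B x + B y" for x y
      by (rule eqI) (simp add: cinner.add_right flip: adj)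
    show "B (r *\<^sub>R x) = r *\<^sub>R B x" for r x
      by (rule eqI) (simp add: cinner.scaleR_right flip: adj)
    show "norm (B y) \<le> norm y * C" for y
    proof (cases "B y = 0")
      case False
      have "(norm (B y))\<^sup>2 = inner (A (B y)) y"
        by (simp add: B power2_norm_eq_inner)
      also have "\<dots> \<le> norm (A (B y)) * norm y"
        by (rule norm_cauchy_schwarz)
      also have "\<dots> \<le> C * norm (B y) * norm y"
        by (intro mult_right_mono C) simp
      finally show ?thesis
        using False by (simp add: power2_eq_square mult_ac)
    qed (use C in auto)
  qed
  moreover have "B (c *\<^sub>C x) = c *\<^sub>C B x" for c x
    by (rule eqI) (simp add: cinner_scaleC_right flip: adj)
  ultimately show ?thesis
    using adj by (auto simp: bounded_clinear_def is_cadjoint_def)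
qed

text \<open>For small \<open>r\<close> the map \<open>x \<mapsto> x - r (B x - y)\<close> is a contraction, and its fixed point solves the equation.\<close>
lemma Lax_Milgram:
  fixes B :: "'a::chilbert_space \<Rightarrow> 'a"
  assumes B: "bounded_clinear B" and "c > 0"
    and coercive: "\<And>x. c * (norm x)\<^sup>2 \<le> inner (B x) x"
  shows "\<exists>x. B x = y"
proof -
  obtain C0 where C0: "C0 > 0" "\<And>x. norm (B x) \<le> C0 * norm x"
    using bounded_clinear_bound[OF B] by blast
  define C where "C = C0 + c"
  have C: "c < C" "C > 0"
    using C0(1) \<open>c > 0\<close> by (simp_all add: C_def)
  have BC: "norm (B x) \<le> C * norm x" for x
  proof -
    have "C0 * norm x \<le> C * norm x"
      using \<open>c > 0\<close> by (intro mult_right_mono) (simp_all add: C_def)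
    then show ?thesis using C0(2)[of x] by linarith
  qed
  \<comment> \<open>this step size minimizes the contraction factor \<open>1 - 2 r c + r\<^sup>2 C\<^sup>2\<close>\<close>
  define r where "r = c / C\<^sup>2"
  define k where "k = sqrt (1 - c\<^sup>2 / C\<^sup>2)"
  have q: "0 \<le> 1 - c\<^sup>2 / C\<^sup>2" "1 - c\<^sup>2 / C\<^sup>2 < 1"
    using C \<open>c > 0\<close> by (simp_all add: power_mono)
  have k: "0 \<le> k" "k < 1" "k\<^sup>2 = 1 - c\<^sup>2 / C\<^sup>2"
    using q by (simp_all add: k_def)
  have contr: "norm (d - r *\<^sub>R B d) \<le> k * norm d" for d
  proof -
    have "(norm (d - r *\<^sub>R B d))\<^sup>2 = (norm d)\<^sup>2 - 2 * r * inner (B d) d + r\<^sup>2 * (norm (B d))\<^sup>2"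
      unfolding power2_norm_eq_inner
      by (simp add: inner_simps inner_commute power2_eq_square algebra_simps)
    also have "\<dots> \<le> (norm d)\<^sup>2 - 2 * r * (c * (norm d)\<^sup>2) + r\<^sup>2 * (C * norm d)\<^sup>2"
      using C BC \<open>c > 0\<close> coercive[of d]
      by (intro add_mono diff_mono mult_left_mono power_mono) (auto simp: r_def)
    also have "\<dots> = (norm d)\<^sup>2 * (1 - 2 * r * c + r\<^sup>2 * C\<^sup>2)"
      by (simp add: power_mult_distrib algebra_simps)
    also have "1 - 2 * r * c + r\<^sup>2 * C\<^sup>2 = k\<^sup>2"
    proof -
      have "r * c = c\<^sup>2 / C\<^sup>2" "r\<^sup>2 * C\<^sup>2 = c\<^sup>2 / C\<^sup>2"
        using C by (simp_all add: r_def power2_eq_square)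
      then show ?thesis by (simp add: k)
    qed
    also have "(norm d)\<^sup>2 * k\<^sup>2 = (k * norm d)\<^sup>2"
      by (simp only: power_mult_distrib mult.commute)
    finally show ?thesis
      by (rule power2_le_imp_le) (simp add: k)
  qed
  have "\<exists>!x. x - r *\<^sub>R (B x - y) = x"
  proof (rule banach_fix_type[OF k(1,2)], intro allI)
    fix u v
    have "(u - r *\<^sub>R (B u - y)) - (v - r *\<^sub>R (B v - y)) = (u - v) - r *\<^sub>R B (u - v)"
      by (simp add: bounded_clinear_diff[OF B] algebra_simps)
    then show "dist (u - r *\<^sub>R (B u - y)) (v - r *\<^sub>R (B v - y)) \<le> k * dist u v"
      using contr[of "u - v"] by (simp only: dist_norm)
  qed
  then show ?thesis
    using \<open>c > 0\<close> C by (auto simp: r_def)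
qed

section \<open>Operators with closed range\<close>

text \<open>The Baire half of the open mapping theorem, on the complete space \<open>range L\<close>: it is the union of the
  closures of the images of balls, so one of these closures contains a ball of \<open>range L\<close>, and by
  symmetry and convexity also one around \<open>0\<close>.\<close>
lemma closed_range_approximate_preimage:
  fixes L :: "'a::real_normed_vector \<Rightarrow> 'b::banach"
  assumes L: "bounded_linear L" and cl: "closed (range L)"
  shows "\<exists>C>0. \<forall>y\<in>range L. \<forall>e>0. \<exists>x. norm x \<le> C * norm y \<and> norm (y - L x) < e"
proof -
  interpret L: bounded_linear L by fact
  define R where "R = range L"
  interpret R: Submetric UNIV "dist :: 'b \<Rightarrow> 'b \<Rightarrow> real" R
    by unfold_locales (auto simp: dist_commute dist_triangle)
  have top: "R.sub.mtopology = top_of_set R"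
    by (metis mtopology_is_euclidean R.mtopology_submetric)
  have complete: "R.sub.mcomplete"
    using cl by (intro R.closedin_mcomplete_imp_mcomplete) (simp_all add: R_def complete_UNIV)
  define F where "F n = closure (L ` cball 0 (real n))" for n
  have FR: "F n \<subseteq> R" for n
    using cl closure_minimal[of "L ` cball 0 (real n)" R] by (auto simp: F_def R_def)
  have "\<exists>n. R.sub.mtopology interior_of F n \<noteq> {}"
  proof (rule ccontr)
    assume "\<not> ?thesis"
    moreover have "closedin R.sub.mtopology (F n)" for n
      unfolding top using FR by (intro closed_subset) (simp_all add: F_def)
    ultimately have "R.sub.mtopology interior_of \<Union> (range F) = {}"
      by (intro R.sub.metric_Baire_category_alt complete) auto
    moreover have "\<Union> (range F) = R"
    proof
      show "R \<subseteq> \<Union> (range F)"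
      proof
        fix y assume "y \<in> R"
        then obtain x where "y = L x" by (auto simp: R_def)
        moreover obtain n where "norm x \<le> real n" using real_arch_simple by blast
        ultimately show "y \<in> \<Union> (range F)"
          using closure_subset by (fastforce simp: F_def)
      qed
    qed (use FR in blast)
    ultimately have "R = {}"
      by (metis interior_of_topspace R.sub.topspace_mtopology)
    then show False by (auto simp: R_def)
  qed
  then obtain n y0 where "y0 \<in> top_of_set R interior_of F n" by (auto simp: top)
  then obtain T where T: "openin (top_of_set R) T" "y0 \<in> T" "T \<subseteq> F n"
    by (auto simp: interior_of_def)
  then obtain d where d: "d > 0" "\<And>y. y \<in> R \<Longrightarrow> dist y y0 < d \<Longrightarrow> y \<in> F n" "y0 \<in> R"
    by (meson openin_euclidean_subtopology_iff subsetD)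
  have step: "\<exists>x. norm x \<le> real n \<and> norm (y - L x) < e" if y: "y \<in> R" "norm y < d" and "e > 0" for y e
  proof -
    have R: "a + b \<in> R" "a - b \<in> R" if "a \<in> R" "b \<in> R" for a b
      using that unfolding R_def by (auto simp flip: L.add L.diff)
    have "y0 + y \<in> F n" "y0 - y \<in> F n"
      using d(2)[of "y0 + y"] d(2)[of "y0 - y"] y d(3) R by (auto simp: dist_norm)
    then obtain a b where a: "norm a \<le> n" "dist (L a) (y0 + y) < e"
      and b: "norm b \<le> n" "dist (L b) (y0 - y) < e"
      using \<open>e > 0\<close> unfolding F_def closure_approachable by fastforce
    define x where "x = (1/2) *\<^sub>R (a - b)"
    have "norm x \<le> n"
      using a b norm_triangle_ineq4[of a b] by (simp add: x_def)
    moreover have "y - L x = (1/2) *\<^sub>R ((y0 + y - L a) - (y0 - y - L b))"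
      by (simp add: x_def L.scaleR L.diff algebra_simps flip: scaleR_left.add)
    then have "norm (y - L x) < e"
      using a(2) b(2) norm_triangle_ineq4[of "y0 + y - L a" "y0 - y - L b"]
      by (simp add: dist_norm norm_minus_commute)
    ultimately show ?thesis by blast
  qed
  define C where "C = 2 * (real n + 1) / d"
  have "\<exists>x. norm x \<le> C * norm y \<and> norm (y - L x) < e" if "y \<in> R" "e > 0" for y e
  proof (cases "y = 0")
    case True
    then show ?thesis using \<open>e > 0\<close> by (intro exI[of _ 0]) (simp add: L.zero)
  next
    case False
    define s where "s = d / (2 * norm y)"
    have s: "s > 0" using False d by (simp add: s_def)
    obtain v where v: "y = L v" using \<open>y \<in> R\<close> by (auto simp: R_def)
    have "s *\<^sub>R y \<in> R" using v by (auto simp: R_def simp flip: L.scaleR)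
    moreover have "norm (s *\<^sub>R y) < d" using False d by (simp add: s_def)
    moreover have "s * e > 0" using s \<open>e > 0\<close> by simp
    ultimately obtain x where x: "norm x \<le> real n" "norm (s *\<^sub>R y - L x) < s * e"
      using step by blast
    have "s *\<^sub>R y - L x = s *\<^sub>R (y - L (x /\<^sub>R s))"
      using s by (simp add: L.scaleR scaleR_diff_right)
    then have "norm (y - L (x /\<^sub>R s)) < e"
      using x(2) s by simp
    moreover have "norm (x /\<^sub>R s) \<le> C * norm y"
    proof -
      have "norm (x /\<^sub>R s) = norm x * (2 * norm y) / d"
        using s d by (simp add: s_def field_simps)
      also have "\<dots> \<le> (real n + 1) * (2 * norm y) / d"
        using x(1) d by (intro divide_right_mono mult_right_mono) auto
      finally show ?thesis by (simp add: C_def mult_ac)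
    qed
    ultimately show ?thesis by blast
  qed
  moreover have "C > 0" using d by (simp add: C_def)
  ultimately show ?thesis by (auto simp: R_def)
qed

text \<open>The exact version follows by applying the approximate one repeatedly to the remaining error, which
  halves each time, and summing the corrections.\<close>
lemma closed_range_bounded_preimage:
  fixes L :: "'a::banach \<Rightarrow> 'b::banach"
  assumes L: "bounded_linear L" and cl: "closed (range L)"
  shows "\<exists>C>0. \<forall>y\<in>range L. \<exists>x. L x = y \<and> norm x \<le> C * norm y"
proof -
  interpret L: bounded_linear L by fact
  obtain C where C: "C > 0"
    "\<And>y e. y \<in> range L \<Longrightarrow> e > 0 \<Longrightarrow> \<exists>x. norm x \<le> C * norm y \<and> norm (y - L x) < e"
    using closed_range_approximate_preimage[OF assms] by blast
  have "\<exists>x. norm x \<le> C * norm y \<and> norm (y - L x) \<le> norm y / 2" if "y \<in> range L" for y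
  proof (cases "y = 0")
    case True
    then show ?thesis by (intro exI[of _ 0]) (simp add: L.zero)
  next
    case False
    then show ?thesis
      using C(2)[OF that, of "norm y / 2"] by (auto intro: less_imp_le)
  qed
  then obtain g where g: "\<And>y. y \<in> range L \<Longrightarrow> norm (g y) \<le> C * norm y"
    "\<And>y. y \<in> range L \<Longrightarrow> norm (y - L (g y)) \<le> norm y / 2"
    by metis
  have "\<exists>x. L x = y \<and> norm x \<le> 2 * C * norm y" if y: "y \<in> range L" for y
  proof -
    define r where "r n = ((\<lambda>z. z - L (g z)) ^^ n) y" for n
    have r_Suc: "r (Suc n) = r n - L (g (r n))" and r_0: "r 0 = y" for n
      by (simp_all add: r_def)
    have r_range: "r n \<in> range L" for n
    proof (induction n)
      case (Suc n)
      then obtain v where "r n = L v" by blast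
      then have "r (Suc n) = L (v - g (r n))" by (simp add: r_Suc L.diff)
      then show ?case by blast
    qed (simp add: r_0 y)
    have r_bound: "norm (r n) \<le> norm y * (1/2) ^ n" for n
    proof (induction n)
      case (Suc n)
      then show ?case using g(2)[OF r_range[of n]] by (simp add: r_Suc)
    qed (simp add: r_0)
    have gb: "norm (g (r n)) \<le> C * norm y * (1/2) ^ n" for n
      using order_trans[OF g(1)[OF r_range[of n]] mult_left_mono[OF r_bound[of n], of C]] C(1)
      by (simp add: mult.assoc)
    have geo: "(\<lambda>n. C * norm y * (1/2) ^ n) sums (C * norm y * 2)"
      using sums_mult[OF geometric_sums[of "1/2::real"]] by simp
    have sm: "summable (\<lambda>n. g (r n))"
      by (rule summable_comparison_test'[OF sums_summable[OF geo], of 0]) (use gb in simp)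
    have "(\<lambda>n. L (g (r n))) sums (L (\<Sum>n. g (r n)))"
      by (rule L.sums[OF summable_sums[OF sm]])
    moreover have "(\<lambda>n. L (g (r n))) sums y"
    proof -
      have "(\<lambda>n. norm y * (1/2) ^ n) \<longlonglongrightarrow> 0"
        by (intro tendsto_mult_right_zero LIMSEQ_realpow_zero) auto
      then have "r \<longlonglongrightarrow> 0"
        by (rule Lim_null_comparison[rotated]) (use r_bound in simp)
      then show ?thesis
        using telescope_sums'[of r 0] by (simp add: r_Suc r_0)
    qed
    ultimately have "L (\<Sum>n. g (r n)) = y"
      using sums_unique2 by blast
    moreover have "norm (\<Sum>n. g (r n)) \<le> (\<Sum>n. C * norm y * (1/2) ^ n)"
      by (rule norm_suminf_le[OF gb sums_summable[OF geo]])
    ultimately show ?thesis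
      using sums_unique[OF geo] by (auto simp: mult_ac)
  qed
  then show ?thesis
    using C(1) by (intro exI[of _ "2 * C"]) auto
qed

section \<open>Weakly null nets\<close>

text \<open>Used to pass from \<open>\<langle>T x\<^sub>i, x\<^sub>i\<rangle> \<rightarrow> 0\<close> to \<open>T x\<^sub>i \<rightarrow> 0\<close>, and from a zero of the form of \<open>T\<close>
  to a vector in its kernel.\<close>
lemma psd_norm_bound:
  fixes T :: "'a::real_inner \<Rightarrow> 'a"
  assumes T: "bounded_linear T" and sym: "\<And>x y. inner (T x) y = inner x (T y)"
    and psd: "\<And>x. 0 \<le> inner (T x) x"
  shows "\<exists>C>0. \<forall>x. (norm (T x))\<^sup>2 \<le> C * inner (T x) x"
proof -
  interpret T: bounded_linear T by fact
  obtain C where C: "C > 0" "\<And>x. norm (T x) \<le> norm x * C"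
    using T.pos_bounded by blast
  have "(norm (T x))\<^sup>2 \<le> C * inner (T x) x" for x
  proof -
    define y where "y = T x"
    have "inner (T y) y \<le> norm (T y) * norm y" by (rule norm_cauchy_schwarz)
    also have "\<dots> \<le> norm y * C * norm y" by (intro mult_right_mono C) simp
    finally have Ty: "inner (T y) y \<le> C * (norm y)\<^sup>2" by (simp add: power2_eq_square mult_ac)
    \<comment> \<open>test positivity at \<open>x - T x / C\<close>\<close>
    have "0 \<le> inner (T (x - (1/C) *\<^sub>R y)) (x - (1/C) *\<^sub>R y)"
      by (rule psd)
    also have "\<dots> = inner (T x) x - 2 / C * (norm y)\<^sup>2 + (1/C)\<^sup>2 * inner (T y) y"
      using sym[of y x]
      unfolding power2_norm_eq_inner
      by (simp add: T.diff T.scaleR inner_simps inner_commute y_def power2_eq_square algebra_simps)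
    also have "\<dots> \<le> inner (T x) x - 2 / C * (norm y)\<^sup>2 + (1/C)\<^sup>2 * (C * (norm y)\<^sup>2)"
      by (intro add_left_mono mult_left_mono Ty) simp
    also have "\<dots> = inner (T x) x - (norm y)\<^sup>2 / C"
      using C by (simp add: power2_eq_square field_simps)
    finally show ?thesis using C by (simp add: y_def field_simps)
  qed
  then show ?thesis using C by blast
qed

text \<open>Nets along a filter rather than sequences, because a net indexed by the finite sets of test vectors can
  be made weakly null by construction, in a space of any dimension.\<close>
definition weakly_null :: "('i \<Rightarrow> 'a::chilbert_space) \<Rightarrow> 'i filter \<Rightarrow> bool"
  where "weakly_null x F \<longleftrightarrow> (\<forall>y. ((\<lambda>i. cinner (x i) y) \<longlongrightarrow> 0) F)"

lemma weakly_nullD: "weakly_null x F \<Longrightarrow> ((\<lambda>i. cinner (x i) y) \<longlongrightarrow> 0) F"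
  by (simp add: weakly_null_def)

lemma weakly_null_plus:
  "weakly_null x F \<Longrightarrow> weakly_null y F \<Longrightarrow> weakly_null (\<lambda>i. x i + y i) F"
  unfolding weakly_null_def cinner_add_left by (auto intro: tendsto_add_zero)

lemma weakly_null_diff:
  "weakly_null x F \<Longrightarrow> weakly_null y F \<Longrightarrow> weakly_null (\<lambda>i. x i - y i) F"
  unfolding weakly_null_def cinner.diff_left using tendsto_diff[of _ 0 _ _ 0] by fastforce

lemma weakly_null_op:
  fixes L :: "'a::chilbert_space \<Rightarrow> 'a"
  shows "bounded_clinear L \<Longrightarrow> weakly_null x F \<Longrightarrow> weakly_null (\<lambda>i. L (x i)) F"
  using cadjoint_exists[of L] unfolding weakly_null_def is_cadjoint_def by auto

lemma norm_null_imp_weakly_null: "(x \<longlongrightarrow> 0) F \<Longrightarrow> weakly_null x F"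
  unfolding weakly_null_def
  using cinner.tendsto[OF _ tendsto_const, of x 0 F] by (simp add: cinner.zero_left)

text \<open>The image of the ball is totally bounded, so up to a small error \<open>\<parallel>K x\<parallel>\<^sup>2\<close> is \<open>\<langle>K x, y\<rangle>\<close> for one of finitely
  many \<open>y\<close>, and these inner products tend to \<open>0\<close>.\<close>
lemma compact_operator_weakly_null_unit:
  fixes K :: "'a::chilbert_space \<Rightarrow> 'a"
  assumes K: "compact_operator K" and x: "weakly_null x F" "\<And>i. norm (x i) \<le> 1"
  shows "((\<lambda>i. K (x i)) \<longlongrightarrow> 0) F"
proof (rule tendstoI)
  fix e :: real assume "e > 0"
  have Kl: "bounded_clinear K" using K by (simp add: compact_operator_def)
  obtain C where C: "C > 0" "\<And>x. norm (K x) \<le> C * norm x"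
    using bounded_clinear_bound[OF Kl] by blast
  define d where "d = e\<^sup>2 / (2 * C)"
  have "d > 0" using \<open>e > 0\<close> C by (simp add: d_def)
  then obtain k where k: "finite k" "closure (K ` cball 0 1) \<subseteq> (\<Union>y\<in>k. ball y d)"
    using K unfolding compact_operator_def compact_eq_totally_bounded by meson
  have "((\<lambda>i. \<Sum>y\<in>k. cmod (cinner (K (x i)) y)) \<longlongrightarrow> 0) F"
    using weakly_nullD[OF weakly_null_op[OF Kl x(1)]]
    by (intro tendsto_null_sum tendsto_norm_zero)
  moreover have "e\<^sup>2 / 2 > 0" using \<open>e > 0\<close> by simp
  ultimately have "\<forall>\<^sub>F i in F. (\<Sum>y\<in>k. cmod (cinner (K (x i)) y)) < e\<^sup>2 / 2"
    by (rule order_tendstoD(2))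
  then show "\<forall>\<^sub>F i in F. dist (K (x i)) 0 < e"
  proof eventually_elim
    case (elim i)
    define v where "v = K (x i)"
    have "v \<in> closure (K ` cball 0 1)"
      using x(2)[of i] closure_subset by (fastforce simp: v_def)
    then obtain y where y: "y \<in> k" "norm (v - y) < d"
      using k(2) by (auto simp: dist_norm norm_minus_commute)
    have "norm v \<le> C"
      using order_trans[OF C(2)[of "x i"] mult_left_mono[OF x(2)[of i], of C]] C(1)
      by (simp add: v_def)
    have "(norm v)\<^sup>2 = inner v (v - y) + Re (cinner v y)"
      by (simp add: power2_norm_eq_inner inner_simps flip: inner_eq_Re_cinner)
    also have "\<dots> \<le> norm v * norm (v - y) + cmod (cinner v y)"
      by (intro add_mono norm_cauchy_schwarz complex_Re_le_cmod)
    also have "\<dots> \<le> C * d + (\<Sum>y\<in>k. cmod (cinner v y))"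
      using \<open>norm v \<le> C\<close> y k(1) C(1)
      by (intro add_mono mult_mono member_le_sum) auto
    also have "C * d = e\<^sup>2 / 2" using C by (simp add: d_def)
    finally have "(norm v)\<^sup>2 < e\<^sup>2" using elim by (simp add: v_def)
    then show ?case using \<open>e > 0\<close> by (simp add: v_def power2_less_imp_less)
  qed
qed

lemma compact_operator_weakly_null:
  fixes K :: "'a::chilbert_space \<Rightarrow> 'a"
  assumes K: "compact_operator K" and x: "weakly_null x F" "\<And>i. norm (x i) \<le> R"
  shows "((\<lambda>i. K (x i)) \<longlongrightarrow> 0) F"
proof -
  define r where "r = \<bar>R\<bar> + 1"
  have r: "r > 0" by (simp add: r_def)
  have Kl: "bounded_clinear K" using K by (simp add: compact_operator_def)
  have "weakly_null (\<lambda>i. complex_of_real (1/r) *\<^sub>C x i) F"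
    using weakly_null_op[OF bounded_clinear_cmult[OF bounded_clinear_id] x(1)] .
  moreover have "norm (complex_of_real (1/r) *\<^sub>C x i) \<le> 1" for i
  proof -
    have "norm (complex_of_real (1/r) *\<^sub>C x i) = norm (x i) / r"
      using r by (simp add: norm_scaleC norm_divide)
    also have "\<dots> \<le> 1"
      using x(2)[of i] r by (simp add: r_def)
    finally show ?thesis .
  qed
  ultimately have "((\<lambda>i. K (complex_of_real (1/r) *\<^sub>C x i)) \<longlongrightarrow> 0) F"
    by (rule compact_operator_weakly_null_unit[OF K])
  then have "((\<lambda>i. complex_of_real r *\<^sub>C K (complex_of_real (1/r) *\<^sub>C x i)) \<longlongrightarrow> complex_of_real r *\<^sub>C 0) F"
    by (intro scaleC.tendsto tendsto_const)
  moreover have "complex_of_real r *\<^sub>C K (complex_of_real (1/r) *\<^sub>C x i) = K (x i)" for i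
    using r by (simp add: bounded_clinear_scaleC[OF Kl] scaleC_scaleC scaleC_one flip: of_real_mult)
  ultimately show ?thesis by (simp add: scaleC.zero_right)
qed

lemma orthonormal_expansion:
  assumes "finite E" and E: "\<And>e f. e \<in> E \<Longrightarrow> f \<in> E \<Longrightarrow> cinner e f = (if e = f then 1 else 0)"
    and "x \<in> cspan E"
  shows "x = (\<Sum>e\<in>E. cinner x e *\<^sub>C e)"
  using \<open>x \<in> cspan E\<close>
proof (induction rule: complex_vector.span_induct)
  case base
  show ?case
  proof (rule complex_vector.subspaceI; unfold mem_Collect_eq)
    show "0 = (\<Sum>e\<in>E. cinner 0 e *\<^sub>C e)"
      by (simp add: cinner.zero_left scaleC.zero_left)
    show "x + y = (\<Sum>e\<in>E. cinner (x + y) e *\<^sub>C e)"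
      if "x = (\<Sum>e\<in>E. cinner x e *\<^sub>C e)" "y = (\<Sum>e\<in>E. cinner y e *\<^sub>C e)" for x y
      using that by (simp only: cinner_add_left scaleC_add_left sum.distrib)
    show "c *\<^sub>C x = (\<Sum>e\<in>E. cinner (c *\<^sub>C x) e *\<^sub>C e)"
      if "x = (\<Sum>e\<in>E. cinner x e *\<^sub>C e)" for c x
    proof -
      have "(\<Sum>e\<in>E. cinner (c *\<^sub>C x) e *\<^sub>C e) = c *\<^sub>C (\<Sum>e\<in>E. cinner x e *\<^sub>C e)"
        by (simp only: cinner_scaleC_left scaleC_scaleC [symmetric] scaleC.sum_right)
      then show ?thesis using that by simp
    qed
  qed
next
  case (step e)
  then have "(\<Sum>f\<in>E. cinner e f *\<^sub>C f) = (\<Sum>f\<in>E. if e = f then f else 0)"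
    using E by (intro sum.cong) (auto simp: scaleC_one scaleC.zero_left)
  then show ?case using step \<open>finite E\<close> by simp
qed

lemma Gram_Schmidt:
  assumes "finite (B :: 'a::chilbert_space set)"
  shows "\<exists>E. finite E \<and> cspan B \<subseteq> cspan E \<and>
    (\<forall>e\<in>E. \<forall>f\<in>E. cinner e f = (if e = f then 1 else 0))"
  using assms
proof (induction B)
  case empty
  then show ?case by (intro exI[of _ "{}"]) auto
next
  case (insert b B)
  then obtain E where E: "finite E" "cspan B \<subseteq> cspan E"
    "\<And>e f. e \<in> E \<Longrightarrow> f \<in> E \<Longrightarrow> cinner e f = (if e = f then 1 else 0)"
    by blast
  define p where "p = (\<Sum>e\<in>E. cinner b e *\<^sub>C e)"
  define r where "r = b - p"
  have p: "p \<in> cspan E"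
    unfolding p_def
    by (intro complex_vector.span_sum complex_vector.span_scale complex_vector.span_base)
  have r0: "cinner r f = 0" if "f \<in> E" for f
  proof -
    have "cinner p f = (\<Sum>e\<in>E. if e = f then cinner b f else 0)"
      unfolding p_def cinner.sum_left using E that
      by (intro sum.cong) (auto simp: cinner_scaleC_left)
    then show ?thesis using E(1) that by (simp add: r_def cinner.diff_left)
  qed
  show ?case
  proof (cases "r = 0")
    case True
    then have "b \<in> cspan E" using p by (simp add: r_def)
    then have "cspan (insert b B) \<subseteq> cspan E"
      using E(2) complex_vector.span_superset[of B]
      by (intro complex_vector.span_minimal complex_vector.subspace_span) auto
    then show ?thesis using E by blast
  next
    case False
    define u where "u = complex_of_real (1 / norm r) *\<^sub>C r"
    have u: "cinner u u = 1"
      using False by (simp add: u_def cinner_self norm_scaleC norm_divide)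
    have u0: "cinner u f = 0" "cinner f u = 0" if "f \<in> E" for f
      using r0[OF that] cinner_commute[of f u] by (simp_all add: u_def cinner_scaleC_left)
    have "r = complex_of_real (norm r) *\<^sub>C u"
      using False by (simp add: u_def scaleC_scaleC scaleC_one flip: of_real_mult)
    then have "b = p + complex_of_real (norm r) *\<^sub>C u"
      by (simp add: r_def)
    moreover have "p \<in> cspan (insert u E)"
      using p complex_vector.span_mono[of E "insert u E"] by blast
    ultimately have "b \<in> cspan (insert u E)"
      by (metis complex_vector.span_add complex_vector.span_scale complex_vector.span_base insertI1)
    moreover have "B \<subseteq> cspan (insert u E)"
      using E(2) complex_vector.span_superset[of B] complex_vector.span_mono[of E "insert u E"]
      by blast
    ultimately have "cspan (insert b B) \<subseteq> cspan (insert u E)"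
      by (intro complex_vector.span_minimal complex_vector.subspace_span) auto
    moreover have "u \<notin> E"
      using u u0(1)[of u] by auto
    ultimately show ?thesis
      using E u u0 by (intro exI[of _ "insert u E"]) auto
  qed
qed

text \<open>In a finite-dimensional subspace the finitely many coordinates with respect to an orthonormal basis
  determine the norm.\<close>
lemma weakly_null_finite_dim:
  assumes "finite B" and x: "\<And>i. x i \<in> cspan B" "weakly_null x F"
  shows "(x \<longlongrightarrow> 0) F"
proof -
  obtain E where E: "finite E" "cspan B \<subseteq> cspan E"
    "\<And>e f. e \<in> E \<Longrightarrow> f \<in> E \<Longrightarrow> cinner e f = (if e = f then 1 else 0)"
    using Gram_Schmidt[OF \<open>finite B\<close>] by blast
  have "((\<lambda>i. \<Sum>e\<in>E. cinner (x i) e *\<^sub>C e) \<longlongrightarrow> (\<Sum>e\<in>E. 0 *\<^sub>C e)) F"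
    by (intro tendsto_sum scaleC.tendsto tendsto_const weakly_nullD x)
  moreover have "(\<Sum>e\<in>E. cinner (x i) e *\<^sub>C e) = x i" for i
    using orthonormal_expansion[OF E(1,3), of "x i"] x(1)[of i] E(2) by auto
  ultimately show ?thesis by (simp add: scaleC.zero_left)
qed

text \<open>Closedness of the range allows \<open>x\<^sub>i\<close> to be corrected by a norm-null net into the kernel, where
  weak and norm convergence agree because the kernel has finite dimension.\<close>
lemma fredholm_weakly_null:
  fixes L :: "'a::chilbert_space \<Rightarrow> 'a"
  assumes L: "fredholm_operator L" and x: "weakly_null x F" "((\<lambda>i. L (x i)) \<longlongrightarrow> 0) F"
  shows "(x \<longlongrightarrow> 0) F"
proof -
  have Ll: "bounded_clinear L" and cl: "closed (range L)"
    using L by (auto simp: fredholm_operator_def)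
  obtain B where B: "finite B" "{x. L x = 0} \<subseteq> cspan B"
    using L by (auto simp: fredholm_operator_def)
  obtain C where C: "C > 0" "\<And>y. y \<in> range L \<Longrightarrow> \<exists>x. L x = y \<and> norm x \<le> C * norm y"
    using closed_range_bounded_preimage[OF bounded_clinear_bounded_linear[OF Ll] cl] by blast
  then have "\<forall>i. \<exists>x'. L x' = L (x i) \<and> norm x' \<le> C * norm (L (x i))"
    by blast
  then obtain x' where x': "\<And>i. L (x' i) = L (x i)" "\<And>i. norm (x' i) \<le> C * norm (L (x i))"
    by metis
  have x'0: "(x' \<longlongrightarrow> 0) F"
  proof (rule Lim_null_comparison)
    show "\<forall>\<^sub>F i in F. norm (x' i) \<le> C * norm (L (x i))" using x'(2) by simp
    show "((\<lambda>i. C * norm (L (x i))) \<longlongrightarrow> 0) F"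
      by (intro tendsto_mult_right_zero tendsto_norm_zero x)
  qed
  have "((\<lambda>i. x i - x' i) \<longlongrightarrow> 0) F"
  proof (rule weakly_null_finite_dim[OF B(1)])
    show "x i - x' i \<in> cspan B" for i
      using B(2) x'(1)[of i] by (auto simp: bounded_clinear_diff[OF Ll])
    show "weakly_null (\<lambda>i. x i - x' i) F"
      by (intro weakly_null_diff x norm_null_imp_weakly_null x'0)
  qed
  from tendsto_add[OF this x'0] show ?thesis by simp
qed

section \<open>Boundary points outside the essential spectrum\<close>

lemma tendsto_zero_power2_bound:
  fixes f :: "'i \<Rightarrow> 'a::real_normed_vector"
  assumes "(g \<longlongrightarrow> 0) F" and "\<And>i. (norm (f i))\<^sup>2 \<le> g i"
  shows "(f \<longlongrightarrow> 0) F"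
proof -
  have "((\<lambda>i. (norm (f i))\<^sup>2) \<longlongrightarrow> 0) F"
    by (rule Lim_null_comparison[OF _ assms(1)]) (simp add: assms(2))
  then show ?thesis by (simp add: tendsto_norm_zero_iff)
qed

lemma self_adjoint_form_real:
  assumes "is_cadjoint Z Z" shows "Im (cinner (Z x) x) = 0"
proof -
  have "cinner (Z x) x = cinner x (Z x)"
    using assms by (simp add: is_cadjoint_def)
  also have "\<dots> = cnj (cinner (Z x) x)"
    by (rule cinner_commute)
  finally show ?thesis
    by (simp add: complex_eq_iff)
qed

text \<open>If \<open>y\<^sub>i\<close> is asymptotically fixed by the real part \<open>X\<close> of the operator, then the bound
  \<open>\<parallel>y\<parallel>\<^sup>2\<close> on its form is asymptotically attained by the real part of the form, which
  leaves nothing for the imaginary part \<open>Y\<close>.\<close>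
lemma compact_perturbation_quadratic_form:
  fixes X Y K :: "'a::chilbert_space \<Rightarrow> 'a"
  assumes X: "is_cadjoint X X" and Y: "is_cadjoint Y Y"
    and K_null: "((\<lambda>i. K (y i)) \<longlongrightarrow> 0) F"
    and bound: "\<And>x. cmod (cinner (X x + \<i> *\<^sub>C Y x + K x) x) \<le> (norm x)\<^sup>2"
    and R: "\<And>i. norm (y i) \<le> R"
    and Xy: "((\<lambda>i. X (y i) - y i) \<longlongrightarrow> 0) F"
  shows "((\<lambda>i. inner (Y (y i)) (y i)) \<longlongrightarrow> 0) F"
proof -
  have bounded_inner: "((\<lambda>i. R * norm (f i)) \<longlongrightarrow> 0) F" if "(f \<longlongrightarrow> 0) F" for f :: "_ \<Rightarrow> 'a"
    using that by (intro tendsto_mult_right_zero tendsto_norm_zero)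
  define k where "k i = cmod (cinner (K (y i)) (y i))" for i
  define h where "h i = inner (X (y i) - y i) (y i)" for i
  have k0: "(k \<longlongrightarrow> 0) F"
  proof (rule Lim_null_comparison[OF _ bounded_inner[OF K_null]])
    show "\<forall>\<^sub>F i in F. norm (k i) \<le> R * norm (K (y i))"
      using order_trans[OF cinner_Cauchy_Schwarz mult_left_mono[OF R norm_ge_zero]]
      by (simp add: k_def mult.commute)
  qed
  have h0: "(h \<longlongrightarrow> 0) F"
  proof (rule Lim_null_comparison[OF _ bounded_inner[OF Xy]])
    show "\<forall>\<^sub>F i in F. norm (h i) \<le> R * norm (X (y i) - y i)"
      using order_trans[OF Cauchy_Schwarz_ineq2 mult_left_mono[OF R norm_ge_zero]]
      by (simp add: h_def mult.commute)
  qed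
  have sa: "cinner (Z x) x = complex_of_real (inner (Z x) x)" if "is_cadjoint Z Z" for Z and x :: 'a
    using self_adjoint_form_real[OF that] by (simp add: inner_eq_Re_cinner complex_eq_iff)
  have main: "(inner (Y (y i)) (y i))\<^sup>2 \<le> \<bar>k i - h i\<bar> * (2 * R\<^sup>2 + \<bar>k i + h i\<bar>)" for i
  proof -
    define a b n where "a = inner (X (y i)) (y i)" and "b = inner (Y (y i)) (y i)"
      and "n = (norm (y i))\<^sup>2"
    have "Complex a b = cinner (X (y i) + \<i> *\<^sub>C Y (y i) + K (y i)) (y i) - cinner (K (y i)) (y i)"
      using sa[OF X, of "y i"] sa[OF Y, of "y i"]
      by (simp add: cinner_simps a_def b_def Complex_eq)
    also have "cmod \<dots> \<le> n + k i"
      unfolding k_def n_def by (rule order_trans[OF norm_triangle_ineq4 add_right_mono[OF bound]])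
    finally have "sqrt (a\<^sup>2 + b\<^sup>2) \<le> n + k i"
      by (simp add: cmod_def)
    then have "a\<^sup>2 + b\<^sup>2 \<le> (n + k i)\<^sup>2"
      by (rule sqrt_le_D)
    moreover have "a = n + h i"
      by (simp add: a_def n_def h_def inner_diff_left power2_norm_eq_inner)
    ultimately have *: "b\<^sup>2 \<le> (k i - h i) * (2 * n + (k i + h i))"
      by (simp add: power2_eq_square algebra_simps)
    have "n \<le> R\<^sup>2" unfolding n_def by (rule power_mono[OF R]) simp
    note *
    also have "(k i - h i) * (2 * n + (k i + h i)) \<le> \<bar>k i - h i\<bar> * \<bar>2 * n + (k i + h i)\<bar>"
      by (simp flip: abs_mult)
    also have "\<dots> \<le> \<bar>k i - h i\<bar> * (2 * R\<^sup>2 + \<bar>k i + h i\<bar>)"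
    proof (intro mult_left_mono)
      have "0 \<le> n" by (simp add: n_def)
      with \<open>n \<le> R\<^sup>2\<close> show "\<bar>2 * n + (k i + h i)\<bar> \<le> 2 * R\<^sup>2 + \<bar>k i + h i\<bar>" by linarith
    qed simp
    finally show ?thesis by (simp add: b_def)
  qed
  have "((\<lambda>i. \<bar>k i - h i\<bar> * (2 * R\<^sup>2 + \<bar>k i + h i\<bar>)) \<longlongrightarrow> \<bar>0 - 0\<bar> * (2 * R\<^sup>2 + \<bar>0 + 0\<bar>)) F"
    by (intro tendsto_intros k0 h0)
  then have "((\<lambda>i. \<bar>k i - h i\<bar> * (2 * R\<^sup>2 + \<bar>k i + h i\<bar>)) \<longlongrightarrow> 0) F"
    by simp
  then show ?thesis
    by (rule tendsto_zero_power2_bound) (simp add: main)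
qed

text \<open>The core of the argument. Positivity of \<open>T = 1 - Re A\<close> turns \<open>\<langle>T x\<^sub>i, x\<^sub>i\<rangle> \<rightarrow> 0\<close> into \<open>X x\<^sub>i - x\<^sub>i \<rightarrow> 0\<close>; the
  imaginary part is then eliminated by testing its form, which tends to \<open>0\<close>, on both
  \<open>x\<^sub>i + Y x\<^sub>i\<close> and \<open>x\<^sub>i - Y x\<^sub>i\<close>. Commutativity keeps these nets asymptotically fixed by \<open>X\<close>.\<close>
lemma essential_boundary_approximate_eigenvectors:
  fixes X Y K :: "'a::chilbert_space \<Rightarrow> 'a"
  assumes X: "bounded_clinear X" "is_cadjoint X X" and Y: "bounded_clinear Y" "is_cadjoint Y Y"
    and comm: "\<And>x. X (Y x) = Y (X x)"
    and K: "bounded_clinear K"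
    and K_null: "\<And>y R. weakly_null y F \<Longrightarrow> (\<And>i. norm (y i) \<le> R) \<Longrightarrow> ((\<lambda>i. K (y i)) \<longlongrightarrow> 0) F"
    and bound: "\<And>x. cmod (cinner (X x + \<i> *\<^sub>C Y x + K x) x) \<le> (norm x)\<^sup>2"
    and x: "weakly_null x F" "\<And>i. norm (x i) = 1"
    and lim: "((\<lambda>i. Re (cinner (X (x i) + \<i> *\<^sub>C Y (x i) + K (x i)) (x i))) \<longlongrightarrow> 1) F"
  shows "((\<lambda>i. X (x i) + \<i> *\<^sub>C Y (x i) + K (x i) - x i) \<longlongrightarrow> 0) F"
proof -
  obtain K' where K': "bounded_clinear K'" "is_cadjoint K K'"
    using cadjoint_exists[OF K] by blast
  have adj: "inner (X u) v = inner u (X v)" "inner (Y u) v = inner u (Y v)"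
    "inner (K u) v = inner u (K' v)" "inner (K' u) v = inner u (K v)" for u v
    using X(2) Y(2) K'(2) is_cadjoint_commute[OF K'(2)]
    by (simp_all add: is_cadjoint_def inner_eq_Re_cinner)
  have Kx: "((\<lambda>i. K (x i)) \<longlongrightarrow> 0) F"
    by (rule K_null[of x 1]) (simp_all add: x)
  \<comment> \<open>compactness of \<open>K\<close> controls its adjoint through \<open>\<parallel>K' x\<parallel>\<^sup>2 = \<langle>K (K' x), x\<rangle>\<close>\<close>
  have K'x: "((\<lambda>i. K' (x i)) \<longlongrightarrow> 0) F"
  proof -
    obtain C where C: "\<And>v. norm (K' v) \<le> C * norm v"
      using bounded_clinear_bound[OF K'(1)] by blast
    have "((\<lambda>i. K (K' (x i))) \<longlongrightarrow> 0) F"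
    proof (rule K_null[OF weakly_null_op[OF K'(1) x(1)]])
      show "norm (K' (x i)) \<le> C" for i
        using C[of "x i"] by (simp add: x(2))
    qed
    then have "((\<lambda>i. norm (K (K' (x i)))) \<longlongrightarrow> 0) F"
      by (rule tendsto_norm_zero)
    then show ?thesis
    proof (rule tendsto_zero_power2_bound)
      fix i
      have "(norm (K' (x i)))\<^sup>2 = inner (K (K' (x i))) (x i)"
        by (simp add: adj power2_norm_eq_inner)
      also have "\<dots> \<le> norm (K (K' (x i))) * norm (x i)"
        by (rule norm_cauchy_schwarz)
      finally show "(norm (K' (x i)))\<^sup>2 \<le> norm (K (K' (x i)))" by (simp add: x(2))
    qed
  qed
  define T where "T v = v - X v - (1/2) *\<^sub>R (K v + K' v)" for v
  have T_lin: "bounded_linear T"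
    unfolding T_def
    by (intro bounded_linear_sub bounded_linear_ident bounded_linear_add bounded_clinear_bounded_linear
        X K K' bounded_linear_const_scaleR)
  have T_form: "inner (T v) v = (norm v)\<^sup>2 - Re (cinner (X v + \<i> *\<^sub>C Y v + K v) v)" for v
  proof -
    have "Im (cinner (Y v) v) = 0"
      by (rule self_adjoint_form_real[OF Y(2)])
    moreover have "inner (K' v) v = inner (K v) v"
      by (subst adj(4)) (rule inner_commute)
    ultimately show ?thesis
      by (simp add: T_def inner_simps power2_norm_eq_inner cinner_simps flip: inner_eq_Re_cinner)
  qed
  obtain C where C: "C > 0" "\<And>v. (norm (T v))\<^sup>2 \<le> C * inner (T v) v"
  proof -
    have "inner (T u) v = inner u (T v)" for u v
      by (simp add: T_def inner_simps adj)
    moreover have "0 \<le> inner (T v) v" for v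
      using bound[of v] complex_Re_le_cmod[of "cinner (X v + \<i> *\<^sub>C Y v + K v) v"]
      by (simp add: T_form)
    ultimately show ?thesis using psd_norm_bound[OF T_lin] that by blast
  qed
  have Tx: "((\<lambda>i. T (x i)) \<longlongrightarrow> 0) F"
  proof -
    have "((\<lambda>i. C * inner (T (x i)) (x i)) \<longlongrightarrow> C * (1 - 1)) F"
      unfolding T_form x(2) power_one by (intro tendsto_intros lim)
    then have "((\<lambda>i. C * inner (T (x i)) (x i)) \<longlongrightarrow> 0) F" by simp
    then show ?thesis by (rule tendsto_zero_power2_bound) (rule C(2))
  qed
  have Xx: "((\<lambda>i. X (x i) - x i) \<longlongrightarrow> 0) F"
  proof -
    have "((\<lambda>i. - T (x i) - (1/2) *\<^sub>R (K (x i) + K' (x i))) \<longlongrightarrow> - 0 - (1/2) *\<^sub>R (0 + 0)) F"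
      by (intro tendsto_intros Tx Kx K'x)
    then show ?thesis by (simp add: T_def algebra_simps)
  qed
  have Yx: "((\<lambda>i. Y (x i)) \<longlongrightarrow> 0) F"
  proof -
    obtain c where c: "c > 0" "\<And>v. norm (Y v) \<le> c * norm v"
      using bounded_clinear_bound[OF Y(1)] by blast
    have YXx: "((\<lambda>i. Y (X (x i) - x i)) \<longlongrightarrow> 0) F"
      using bounded_linear.tendsto[OF bounded_clinear_bounded_linear[OF Y(1)] Xx]
      by (simp add: bounded_clinear_zero[OF Y(1)])
    have plus: "((\<lambda>i. inner (Y (x i + Y (x i))) (x i + Y (x i))) \<longlongrightarrow> 0) F"
    proof (rule compact_perturbation_quadratic_form[OF X(2) Y(2) _ bound])
      show "norm (x i + Y (x i)) \<le> 1 + c" for i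
        using norm_triangle_ineq[of "x i" "Y (x i)"] c(2)[of "x i"] x(2)[of i] by simp
      then show "((\<lambda>i. K (x i + Y (x i))) \<longlongrightarrow> 0) F"
        by (intro K_null weakly_null_plus weakly_null_op[OF Y(1)] x)
      show "((\<lambda>i. X (x i + Y (x i)) - (x i + Y (x i))) \<longlongrightarrow> 0) F"
        using tendsto_add[OF Xx YXx]
        by (simp add: bounded_clinear_add[OF X(1)] bounded_clinear_diff[OF Y(1)] comm algebra_simps)
    qed
    have minus: "((\<lambda>i. inner (Y (x i - Y (x i))) (x i - Y (x i))) \<longlongrightarrow> 0) F"
    proof (rule compact_perturbation_quadratic_form[OF X(2) Y(2) _ bound])
      show "norm (x i - Y (x i)) \<le> 1 + c" for i
        using norm_triangle_ineq4[of "x i" "Y (x i)"] c(2)[of "x i"] x(2)[of i] by simp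
      then show "((\<lambda>i. K (x i - Y (x i))) \<longlongrightarrow> 0) F"
        by (intro K_null weakly_null_diff weakly_null_op[OF Y(1)] x)
      show "((\<lambda>i. X (x i - Y (x i)) - (x i - Y (x i))) \<longlongrightarrow> 0) F"
        using tendsto_diff[OF Xx YXx]
        by (simp add: bounded_clinear_diff[OF X(1)] bounded_clinear_diff[OF Y(1)] comm algebra_simps)
    qed
    \<comment> \<open>the cross terms \<open>2 \<langle>Y x, Y x\<rangle> + 2 \<langle>Y (Y x), x\<rangle>\<close> are all that survives the subtraction\<close>
    have "inner (Y (x i + Y (x i))) (x i + Y (x i)) - inner (Y (x i - Y (x i))) (x i - Y (x i))
        = 4 * (norm (Y (x i)))\<^sup>2" for i
      using adj(2)[of "Y (x i)" "x i"] unfolding power2_norm_eq_inner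
      by (simp add: bounded_clinear_add[OF Y(1)] bounded_clinear_diff[OF Y(1)] inner_simps)
    then have "((\<lambda>i. 4 * (norm (Y (x i)))\<^sup>2) \<longlongrightarrow> 0) F"
      using tendsto_diff[OF plus minus] by simp
    then show ?thesis by (rule tendsto_zero_power2_bound) simp
  qed
  have "((\<lambda>i. (X (x i) - x i) + \<i> *\<^sub>C Y (x i) + K (x i)) \<longlongrightarrow> 0 + \<i> *\<^sub>C 0 + 0) F"
    by (intro tendsto_add scaleC.tendsto tendsto_const Xx Yx Kx)
  then show ?thesis by (simp add: scaleC.zero_right algebra_simps)
qed

text \<open>Normality supplies the commuting real and imaginary parts \<open>X\<close>, \<open>Y\<close> of \<open>cnj z N\<close>.\<close>
lemma normal_plus_compact_approximate_eigenvectors: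
  fixes N K :: "'a::chilbert_space \<Rightarrow> 'a"
  assumes N: "normal_operator N" and K: "compact_operator K" and z: "cmod z = 1"
    and bound: "\<And>x. cmod (cinner (N x + K x) x) \<le> (norm x)\<^sup>2"
    and x: "weakly_null x F" "\<And>i. norm (x i) = 1"
    and lim: "((\<lambda>i. Re (cnj z * cinner (N (x i) + K (x i)) (x i))) \<longlongrightarrow> 1) F"
  shows "((\<lambda>i. N (x i) + K (x i) - z *\<^sub>C x i) \<longlongrightarrow> 0) F"
proof -
  have z': "z * cnj z = 1"
    using z by (simp flip: complex_norm_square)
  have Kl: "bounded_clinear K" and Nl: "bounded_clinear N"
    using K N by (simp_all add: compact_operator_def normal_operator_def)
  obtain M where M: "bounded_clinear M" "is_cadjoint N M" "N \<circ> M = M \<circ> N"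
    using N by (auto simp: normal_operator_def)
  have comm: "N (M v) = M (N v)" for v
    using M(3) by (metis comp_apply)
  have adj: "cinner (N u) v = cinner u (M v)" "cinner (M u) v = cinner u (N v)" for u v
    using M(2) is_cadjoint_commute[OF M(2)] by (simp_all add: is_cadjoint_def)
  define X where "X v = (1/2) *\<^sub>C (cnj z *\<^sub>C N v + z *\<^sub>C M v)" for v
  define Y where "Y v = (- \<i>/2) *\<^sub>C (cnj z *\<^sub>C N v - z *\<^sub>C M v)" for v
  define K1 where "K1 v = cnj z *\<^sub>C K v" for v
  have XY: "X v + \<i> *\<^sub>C Y v = cnj z *\<^sub>C N v" for v
    by (simp add: X_def Y_def scaleC_scaleC scaleC_add_right scaleC.diff_right
        flip: scaleC_add_left scaleC.diff_left)
  have A: "X v + \<i> *\<^sub>C Y v + K1 v = cnj z *\<^sub>C (N v + K v)" for v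
    by (simp add: XY K1_def scaleC_add_right)
  have "((\<lambda>i. X (x i) + \<i> *\<^sub>C Y (x i) + K1 (x i) - x i) \<longlongrightarrow> 0) F"
  proof (rule essential_boundary_approximate_eigenvectors)
    show "bounded_clinear X" "bounded_clinear Y" "bounded_clinear K1"
      unfolding X_def Y_def K1_def by (intro bounded_clinear_intros Nl M Kl)+
    show "is_cadjoint X X" "is_cadjoint Y Y"
      unfolding is_cadjoint_def X_def Y_def by (simp_all add: cinner_simps adj algebra_simps)
    show "X (Y v) = Y (X v)" for v
      by (simp add: X_def Y_def bounded_clinear_add[OF Nl] bounded_clinear_add[OF M(1)]
          bounded_clinear_diff[OF Nl] bounded_clinear_diff[OF M(1)] bounded_clinear_scaleC[OF Nl]
          bounded_clinear_scaleC[OF M(1)] scaleC_scaleC scaleC_add_right scaleC.diff_right comm mult_ac)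
    show "((\<lambda>i. K1 (y i)) \<longlongrightarrow> 0) F" if "weakly_null y F" "\<And>i. norm (y i) \<le> R" for y R
      using scaleC.tendsto[OF tendsto_const compact_operator_weakly_null[OF K that]]
      by (simp add: K1_def scaleC.zero_right)
    show "cmod (cinner (X v + \<i> *\<^sub>C Y v + K1 v) v) \<le> (norm v)\<^sup>2" for v
      unfolding A using bound[of v] by (simp add: cinner_scaleC_left norm_mult z)
    show "((\<lambda>i. Re (cinner (X (x i) + \<i> *\<^sub>C Y (x i) + K1 (x i)) (x i))) \<longlongrightarrow> 1) F"
      unfolding A using lim by (simp only: cinner_scaleC_left)
  qed (use x in auto)
  then have "((\<lambda>i. cnj z *\<^sub>C (N (x i) + K (x i)) - x i) \<longlongrightarrow> 0) F"
    by (simp only: A)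
  from scaleC.tendsto[OF tendsto_const this, of z]
  show ?thesis
    by (simp add: scaleC.diff_right scaleC_scaleC z' scaleC_one scaleC.zero_right)
qed

text \<open>If no finite set \<open>E\<close> and \<open>d > 0\<close> work, the unit vectors violating the estimate form a
  weakly null net of approximate eigenvectors of \<open>A\<close> at \<open>z\<close>, contradicting that \<open>A - z\<close> is Fredholm.\<close>
lemma coercive_modulo_finite_rank:
  fixes A N K :: "'a::chilbert_space \<Rightarrow> 'a"
  assumes N: "normal_operator N" and K: "compact_operator K" and A: "A = (\<lambda>x. N x + K x)"
    and bound: "\<And>x. cmod (cinner (A x) x) \<le> (norm x)\<^sup>2"
    and z: "cmod z = 1" "z \<notin> essential_spectrum A"
  shows "\<exists>E d. finite E \<and> d > 0 \<and>
    (\<forall>x. norm x = 1 \<longrightarrow> d \<le> 1 - Re (cnj z * cinner (A x) x) + (\<Sum>e\<in>E. (cmod (cinner x e))\<^sup>2))"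
proof (rule ccontr)
  define q where "q x = 1 - Re (cnj z * cinner (A x) x)" for x
  assume "\<not> ?thesis"
  then have neg: "\<exists>x. norm x = 1 \<and> q x + (\<Sum>e\<in>E. (cmod (cinner x e))\<^sup>2) < d"
    if "finite E" "d > 0" for E d
    using that unfolding q_def by (meson not_le)
  have "\<exists>x. norm x = 1 \<and> (finite (fst p) \<longrightarrow>
      q x + (\<Sum>e\<in>fst p. (cmod (cinner x e))\<^sup>2) < 1 / real (Suc (snd p)))"
    for p :: "'a set \<times> nat"
    using neg[of "fst p" "1 / real (Suc (snd p))"] neg[of "{}" 1] by fastforce
  then obtain x :: "'a set \<times> nat \<Rightarrow> 'a" where x: "\<And>p. norm (x p) = 1"
    "\<And>p. finite (fst p) \<Longrightarrow>
      q (x p) + (\<Sum>e\<in>fst p. (cmod (cinner (x p) e))\<^sup>2) < 1 / real (Suc (snd p))"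
    by metis
  define F :: "('a set \<times> nat) filter" where "F = finite_subsets_at_top UNIV \<times>\<^sub>F sequentially"
  have F: "F \<noteq> bot"
    by (simp add: F_def prod_filter_eq_bot)
  have q_nonneg: "0 \<le> q (x p)" for p
    using bound[of "x p"] complex_Re_le_cmod[of "cnj z * cinner (A (x p)) (x p)"]
    by (simp add: q_def norm_mult z x(1))
  have contains: "\<forall>\<^sub>F p in F. finite (fst p) \<and> e \<in> fst p" for e
  proof -
    have "\<forall>\<^sub>F E in finite_subsets_at_top UNIV. finite E \<and> e \<in> E"
      unfolding eventually_finite_subsets_at_top by (intro exI[of _ "{e}"]) auto
    then show ?thesis
      unfolding F_def by (rule eventually_compose_filterlim[OF _ filterlim_fst])
  qed
  have small: "((\<lambda>p. 1 / real (Suc (snd p))) \<longlongrightarrow> 0) F"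
    unfolding F_def
    by (rule filterlim_compose[OF LIMSEQ_Suc[OF lim_inverse_n'] filterlim_snd])
  have wn: "weakly_null x F"
    unfolding weakly_null_def
  proof
    fix e
    have "((\<lambda>p. (cmod (cinner (x p) e))\<^sup>2) \<longlongrightarrow> 0) F"
    proof (rule Lim_null_comparison[OF _ small])
      show "\<forall>\<^sub>F p in F. norm ((cmod (cinner (x p) e))\<^sup>2) \<le> 1 / real (Suc (snd p))"
        using contains[of e]
      proof eventually_elim
        case (elim p)
        then have "(cmod (cinner (x p) e))\<^sup>2 \<le> (\<Sum>e\<in>fst p. (cmod (cinner (x p) e))\<^sup>2)"
          by (intro member_le_sum) auto
        then show ?case using x(2)[of p] q_nonneg[of p] elim by simp
      qed
    qed
    then show "((\<lambda>p. cinner (x p) e) \<longlongrightarrow> 0) F"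
      by (simp add: tendsto_norm_zero_iff)
  qed
  have "((\<lambda>p. q (x p)) \<longlongrightarrow> 0) F"
  proof (rule Lim_null_comparison[OF _ small])
    show "\<forall>\<^sub>F p in F. norm (q (x p)) \<le> 1 / real (Suc (snd p))"
      using contains[of 0]
    proof eventually_elim
      case (elim p)
      have "0 \<le> (\<Sum>e\<in>fst p. (cmod (cinner (x p) e))\<^sup>2)"
        by (intro sum_nonneg) simp
      then show ?case using x(2)[of p] q_nonneg[of p] elim by simp
    qed
  qed
  then have "((\<lambda>p. 1 - q (x p)) \<longlongrightarrow> 1 - 0) F"
    by (intro tendsto_intros)
  then have lim: "((\<lambda>p. Re (cnj z * cinner (N (x p) + K (x p)) (x p))) \<longlongrightarrow> 1) F"
    by (simp add: q_def A)
  have "((\<lambda>p. A (x p) - z *\<^sub>C x p) \<longlongrightarrow> 0) F"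
    unfolding A
    by (rule normal_plus_compact_approximate_eigenvectors[OF N K z(1) _ wn x(1) lim])
      (use bound A in simp)
  then have "(x \<longlongrightarrow> 0) F"
    using z(2) by (intro fredholm_weakly_null[OF _ wn]) (simp_all add: essential_spectrum_def)
  then have "((\<lambda>p. norm (x p)) \<longlongrightarrow> 0) F"
    by (rule tendsto_norm_zero)
  then show False
    using F by (simp add: x(1) tendsto_const_iff)
qed

section \<open>Analytic continuation of the kernel\<close>

text \<open>A matrix \<open>M\<close> has a nonzero fixed vector iff \<open>det (M - 1) = 0\<close>, and this determinant is a polynomial
  in the entries.\<close>
lemma fixed_vectors_analytic_continuation:
  fixes f :: "nat \<Rightarrow> nat \<Rightarrow> complex \<Rightarrow> complex"
  assumes f: "\<And>i j. i < k \<Longrightarrow> j < k \<Longrightarrow> f i j holomorphic_on S"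
    and S: "open S" "connected S" "U \<subseteq> S" "\<xi> \<in> S" "\<xi> islimpt U" "w \<in> S"
    and U: "\<And>z. z \<in> U \<Longrightarrow> \<exists>v. (\<exists>i<k. v i \<noteq> 0) \<and> (\<forall>i<k. (\<Sum>j<k. f i j z * v j) = v i)"
  shows "\<exists>v. (\<exists>i<k. v i \<noteq> 0) \<and> (\<forall>i<k. (\<Sum>j<k. f i j w * v j) = v i)"
proof -
  define M where "M z = mat k k (\<lambda>(i, j). f i j z - (if i = j then 1 else 0))" for z
  have M: "M z \<in> carrier_mat k k" for z
    by (simp add: M_def)
  have M_mult: "vec_index (M z *\<^sub>v vec k v) i = (\<Sum>j<k. f i j z * v j) - v i" if "i < k" for z v i
  proof -
    have "vec_index (M z *\<^sub>v vec k v) i = (\<Sum>j<k. (f i j z - (if i = j then 1 else 0)) * v j)"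
      using that by (simp add: M_def scalar_prod_def atLeast0LessThan)
    also have "\<dots> = (\<Sum>j<k. f i j z * v j - (if i = j then v j else 0))"
      by (intro sum.cong) (auto simp: algebra_simps)
    finally show ?thesis using that by (simp add: sum_subtractf)
  qed
  have det0: "det (M z) = 0 \<longleftrightarrow>
      (\<exists>v. (\<exists>i<k. v i \<noteq> 0) \<and> (\<forall>i<k. (\<Sum>j<k. f i j z * v j) = v i))" for z
    unfolding det_0_iff_vec_prod_zero[OF M]
  proof safe
    fix v assume v: "v \<in> carrier_vec k" "v \<noteq> 0\<^sub>v k" "M z *\<^sub>v v = 0\<^sub>v k"
    then have "v = vec k (\<lambda>i. vec_index v i)" by auto
    then have "(\<Sum>j<k. f i j z * vec_index v j) = vec_index v i" if "i < k" for i
      using M_mult[OF that, of z "\<lambda>i. vec_index v i"] v(3) that by simp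
    moreover have "\<exists>i<k. vec_index v i \<noteq> 0"
      using v(1,2) by (metis carrier_vecD eq_vecI index_zero_vec)
    ultimately show "\<exists>v. (\<exists>i<k. v i \<noteq> 0) \<and> (\<forall>i<k. (\<Sum>j<k. f i j z * v j) = v i)"
      by blast
  next
    fix v i assume v: "\<forall>i<k. (\<Sum>j<k. f i j z * v j) = v i" "i < k" "v i \<noteq> 0"
    show "\<exists>v. v \<in> carrier_vec k \<and> v \<noteq> 0\<^sub>v k \<and> M z *\<^sub>v v = 0\<^sub>v k"
    proof (intro exI conjI)
      show "vec k v \<noteq> 0\<^sub>v k" using v(2,3) by (metis index_vec index_zero_vec(1))
      show "M z *\<^sub>v vec k v = 0\<^sub>v k"
      proof (rule eq_vecI)
        fix i assume "i < dim_vec (0\<^sub>v k :: complex vec)"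
        then show "vec_index (M z *\<^sub>v vec k v) i = vec_index (0\<^sub>v k) i"
          using M_mult[of i z v] v(1) by simp
      qed (simp add: M_def)
    qed simp
  qed
  have "(\<lambda>z. det (M z)) holomorphic_on S"
  proof -
    have "det (M z) = (\<Sum>p | p permutes {0..<k}. signof p *
        (\<Prod>i = 0..<k. f i (p i) z - (if i = p i then 1 else 0)))" for z
      unfolding det_def'[OF M]
    proof (intro sum.cong prod.cong arg_cong2[where f = "(*)"] refl)
      fix p i assume "p \<in> {p. p permutes {0..<k}}" "i \<in> {0..<k}"
      then show "M z $$ (i, p i) = f i (p i) z - (if i = p i then 1 else 0)"
        using permutes_in_image[of p "{0..<k}" i] by (simp add: M_def)
    qed
    moreover have "f i (p i) holomorphic_on S" if "p permutes {0..<k}" "i \<in> {0..<k}" for p i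
      using that f permutes_in_image[OF that(1), of i] by auto
    ultimately show ?thesis
      by (simp only:) (intro holomorphic_intros; simp)
  qed
  then have "det (M w) = 0"
    by (rule analytic_continuation[OF _ S(1-5) _ S(6)]) (simp add: det0 U)
  then show ?thesis by (simp add: det0)
qed

lemma compact_bounded_combinations:
  fixes u :: "nat \<Rightarrow> 'a::chilbert_space"
  shows "compact {\<Sum>j<k. v j *\<^sub>C u j | v. \<forall>j<k. cmod (v j) \<le> M}"
proof (induction k)
  case (Suc k)
  define D where "D k = {\<Sum>j<k. v j *\<^sub>C u j | v. \<forall>j<k. cmod (v j) \<le> M}" for k
  have "D (Suc k) = (\<lambda>(x, a). x + a *\<^sub>C u k) ` (D k \<times> cball 0 M)"
  proof safe
    fix y assume "y \<in> D (Suc k)"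
    then obtain v where v: "y = (\<Sum>j<Suc k. v j *\<^sub>C u j)" "\<forall>j<Suc k. cmod (v j) \<le> M"
      by (auto simp: D_def)
    then have "y = (\<lambda>(x, a). x + a *\<^sub>C u k) (\<Sum>j<k. v j *\<^sub>C u j, v k)"
      by simp
    moreover have "((\<Sum>j<k. v j *\<^sub>C u j), v k) \<in> D k \<times> cball 0 M"
      using v(2) by (auto simp: D_def)
    ultimately show "y \<in> (\<lambda>(x, a). x + a *\<^sub>C u k) ` (D k \<times> cball 0 M)"
      by (rule image_eqI)
  next
    fix x a assume "x \<in> D k" and a: "a \<in> cball (0::complex) M"
    then obtain v where v: "x = (\<Sum>j<k. v j *\<^sub>C u j)" "\<forall>j<k. cmod (v j) \<le> M"
      by (auto simp: D_def)
    have "x + a *\<^sub>C u k = (\<Sum>j<Suc k. (v(k := a)) j *\<^sub>C u j)"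
      by (simp add: v(1))
    moreover have "\<forall>j<Suc k. cmod ((v(k := a)) j) \<le> M"
      using v(2) a by (simp add: less_Suc_eq)
    ultimately show "x + a *\<^sub>C u k \<in> D (Suc k)"
      unfolding D_def by blast
  qed
  moreover have "compact ((\<lambda>(x, a). x + a *\<^sub>C u k) ` (D k \<times> cball 0 M))"
    using Suc.IH unfolding D_def[symmetric]
    by (intro compact_continuous_image compact_Times compact_cball)
      (auto simp: case_prod_unfold intro!: continuous_intros scaleC.continuous_on)
  ultimately show ?case by (simp add: D_def)
qed simp

text \<open>On the unit circle, where \<open>1 / z = cnj z\<close>, this is \<open>1\<close> minus the self-adjoint part of \<open>cnj z A\<close>; writing
  \<open>1 / z\<close> makes the family holomorphic on the punctured plane.\<close>
definition numrange_pencil ::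
  "('a::chilbert_space \<Rightarrow> 'a) \<Rightarrow> ('a \<Rightarrow> 'a) \<Rightarrow> complex \<Rightarrow> 'a \<Rightarrow> 'a"
  where "numrange_pencil A A' z x = x - (1/2) *\<^sub>C ((1/z) *\<^sub>C A x + z *\<^sub>C A' x)"

lemma bounded_clinear_numrange_pencil:
  assumes "bounded_clinear A" "bounded_clinear A'"
  shows "bounded_clinear (numrange_pencil A A' z)"
  unfolding numrange_pencil_def by (intro bounded_clinear_intros assms)

lemma numrange_pencil_diff:
  "numrange_pencil A A' w x - numrange_pencil A A' z x =
    (1/2) *\<^sub>C ((1/z - 1/w) *\<^sub>C A x + (z - w) *\<^sub>C A' x)"
  by (simp add: numrange_pencil_def scaleC.diff_left scaleC.diff_right scaleC_add_right)

lemma numrange_pencil_form: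
  assumes "is_cadjoint A A'" "cmod z = 1"
  shows "inner (numrange_pencil A A' z x) x = (norm x)\<^sup>2 - Re (cnj z * cinner (A x) x)"
proof -
  have "1 / z = cnj z"
    using assms(2) by (simp add: divide_conv_cnj)
  moreover have "cinner (A' x) x = cnj (cinner (A x) x)"
    using assms(1) by (metis is_cadjoint_def cinner_commute)
  ultimately show ?thesis
    by (simp add: numrange_pencil_def inner_diff_left power2_norm_eq_inner
        inner_eq_Re_cinner[of "_ *\<^sub>C _"] cinner_simps add_divide_distrib)
qed

lemma numrange_pencil_symmetric:
  assumes "is_cadjoint A A'" "cmod z = 1"
  shows "inner (numrange_pencil A A' z x) y = inner x (numrange_pencil A A' z y)"
proof -
  have z: "1 / z = cnj z"
    using assms(2) by (simp add: divide_conv_cnj)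
  have "cinner (A u) v = cinner u (A' v)" "cinner (A' u) v = cinner u (A v)" for u v
    using assms(1) is_cadjoint_commute[OF assms(1)] by (simp_all add: is_cadjoint_def)
  then show ?thesis
    by (simp add: numrange_pencil_def inner_eq_Re_cinner cinner_simps z algebra_simps)
qed

lemma pencil_norm_bound:
  assumes A: "bounded_clinear A" "bounded_clinear A'" "is_cadjoint A A'"
    and bound: "\<And>x. cmod (cinner (A x) x) \<le> (norm x)\<^sup>2" and z: "cmod z = 1"
  shows "\<exists>C>0. \<forall>x. (norm (numrange_pencil A A' z x))\<^sup>2 \<le> C * ((norm x)\<^sup>2 - Re (cnj z * cinner (A x) x))"
proof -
  have "0 \<le> (norm x)\<^sup>2 - Re (cnj z * cinner (A x) x)" for x
    using bound[of x] complex_Re_le_cmod[of "cnj z * cinner (A x) x"] by (simp add: norm_mult z)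
  then show ?thesis
    using psd_norm_bound[of "numrange_pencil A A' z"] numrange_pencil_symmetric[OF A(3) z]
      bounded_clinear_bounded_linear[OF bounded_clinear_numrange_pencil[OF A(1,2)]]
    by (simp add: numrange_pencil_form[OF A(3) z])
qed

text \<open>At a unit vector with \<open>\<langle>A x, x\<rangle> = z\<close> the positive form of the pencil vanishes, and so does the pencil.
  Conversely \<open>Re (cnj z w) = 1\<close> and \<open>\<bar>w\<bar> \<le> 1\<close> force \<open>w = z\<close>.\<close>
lemma numerical_range_boundary_iff:
  assumes A: "bounded_clinear A" "bounded_clinear A'" "is_cadjoint A A'"
    and bound: "\<And>x. cmod (cinner (A x) x) \<le> (norm x)\<^sup>2" and z: "cmod z = 1"
  shows "z \<in> numerical_range A \<longleftrightarrow> (\<exists>x. x \<noteq> 0 \<and> numrange_pencil A A' z x = 0)"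
proof
  assume "z \<in> numerical_range A"
  then obtain x where x: "z = cinner (A x) x" "norm x = 1"
    by (auto simp: numerical_range_def)
  obtain C where C: "(norm (numrange_pencil A A' z x))\<^sup>2 \<le> C * ((norm x)\<^sup>2 - Re (cnj z * cinner (A x) x))"
    using pencil_norm_bound[OF A bound z] by blast
  have "cnj z * cinner (A x) x = 1"
    using z by (simp add: x(1)[symmetric] mult.commute flip: complex_norm_square)
  then have "numrange_pencil A A' z x = 0"
    using C by (simp add: x(2))
  then show "\<exists>x. x \<noteq> 0 \<and> numrange_pencil A A' z x = 0"
    using x(2) by (metis norm_zero zero_neq_one)
next
  assume "\<exists>x. x \<noteq> 0 \<and> numrange_pencil A A' z x = 0"
  then obtain x0 where x0: "x0 \<noteq> 0" "numrange_pencil A A' z x0 = 0"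
    by blast
  define x where "x = complex_of_real (1 / norm x0) *\<^sub>C x0"
  have x: "norm x = 1" "numrange_pencil A A' z x = 0"
    using x0 by (simp_all add: x_def norm_scaleC norm_divide scaleC.zero_right
        bounded_clinear_scaleC[OF bounded_clinear_numrange_pencil[OF A(1,2)]])
  define w where "w = cinner (A x) x"
  have "Re (cnj z * w) = 1"
    using numrange_pencil_form[OF A(3) z, of x] x by (simp add: w_def)
  moreover have "cmod w \<le> 1"
    using bound[of x] x(1) by (simp add: w_def)
  moreover have "(cmod (w - z))\<^sup>2 = (cmod w)\<^sup>2 - 2 * Re (cnj z * w) + (cmod z)\<^sup>2"
    unfolding cmod_power2 by (simp add: power2_eq_square algebra_simps)
  ultimately have "(cmod (w - z))\<^sup>2 \<le> 0"
    using z power_mono[of "cmod w" 1 2] by simp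
  then have "w = z" by simp
  then show "z \<in> numerical_range A"
    using x(1) by (auto simp: w_def numerical_range_def)
qed

text \<open>\<open>B(z)\<close> is the pencil bordered by finitely many rank-one operators that make it coercive, and \<open>R(z)\<close> is
  its inverse. Scalar products with \<open>R(z)\<close> are what turns the kernel problem into one for
  matrices.\<close>

context
  fixes A A' :: "'a::chilbert_space \<Rightarrow> 'a" and e :: "nat \<Rightarrow> 'a" and k :: nat
    and c :: real and S :: "complex set" and B R
  assumes A: "bounded_clinear A" "bounded_clinear A'"
    and c: "c > 0" and S: "0 \<notin> S"
  defines "B \<equiv> \<lambda>z x. numrange_pencil A A' z x + (\<Sum>j<k. cinner x (e j) *\<^sub>C e j)"
    and "R \<equiv> \<lambda>z y. SOME x. B z x = y"
  assumes coercive: "\<And>z x. z \<in> S \<Longrightarrow> c * (norm x)\<^sup>2 \<le> inner (B z x) x"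
begin

lemma bordered_clinear: "bounded_clinear (B z)"
  unfolding B_def
  by (intro bounded_clinear_intros bounded_clinear_numrange_pencil A)

lemma bordered_bounded_below: "z \<in> S \<Longrightarrow> norm x \<le> norm (B z x) / c"
proof (cases "x = 0")
  case False
  assume "z \<in> S"
  then have "c * (norm x)\<^sup>2 \<le> norm (B z x) * norm x"
    by (rule order_trans[OF coercive norm_cauchy_schwarz])
  then show ?thesis
    using False c by (simp add: power2_eq_square field_simps)
qed (use c in simp)

lemma bordered_solution: "z \<in> S \<Longrightarrow> B z (R z y) = y"
  unfolding R_def by (rule someI_ex) (rule Lax_Milgram[OF bordered_clinear c coercive])

lemma solution_bordered:
  assumes "z \<in> S" shows "R z (B z x) = x"
proof -
  have "B z (R z (B z x) - x) = 0"
    by (simp add: bounded_clinear_diff[OF bordered_clinear] bordered_solution[OF assms])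
  then show ?thesis
    using bordered_bounded_below[OF assms, of "R z (B z x) - x"] by simp
qed

lemma solution_bound: "z \<in> S \<Longrightarrow> norm (R z y) \<le> norm y / c"
  using bordered_bounded_below[of z "R z y"] by (simp add: bordered_solution)

lemma bordered_diff:
  "B w x - B z x = (1/2) *\<^sub>C ((1/z - 1/w) *\<^sub>C A x + (z - w) *\<^sub>C A' x)"
  using numrange_pencil_diff[of A A' w x z] by (simp add: B_def)

lemma solution_continuous: "continuous_on S (\<lambda>z. R z y)"
  unfolding continuous_on_def
proof
  fix w assume w: "w \<in> S"
  obtain C where C: "C > 0" "\<And>x. norm (A x) \<le> C * norm x"
    using bounded_clinear_bound[OF A(1)] by blast
  obtain C' where C': "C' > 0" "\<And>x. norm (A' x) \<le> C' * norm x"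
    using bounded_clinear_bound[OF A(2)] by blast
  define b where "b = norm y / c"
  define g where "g z = (cmod (1/z - 1/w) * (C * b) + cmod (z - w) * (C' * b)) / c" for z
  have bound: "norm (R z y - R w y) \<le> g z" if z: "z \<in> S" for z
  proof -
    have n: "norm (A (R z y)) \<le> C * b" "norm (A' (R z y)) \<le> C' * b"
      using order_trans[OF C(2) mult_left_mono[OF solution_bound[OF z]]] C(1)
        order_trans[OF C'(2) mult_left_mono[OF solution_bound[OF z]]] C'(1) by (simp_all add: b_def)
    have "B w (R z y - R w y) = B w (R z y) - B z (R z y)"
      by (simp add: bounded_clinear_diff[OF bordered_clinear] bordered_solution z w)
    also have "norm \<dots> = norm ((1/z - 1/w) *\<^sub>C A (R z y) + (z - w) *\<^sub>C A' (R z y)) / 2"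
      unfolding bordered_diff by (simp add: norm_scaleC norm_divide)
    also have "\<dots> \<le> norm ((1/z - 1/w) *\<^sub>C A (R z y) + (z - w) *\<^sub>C A' (R z y))"
      by simp
    also have "\<dots> \<le> cmod (1/z - 1/w) * norm (A (R z y)) + cmod (z - w) * norm (A' (R z y))"
      by (rule order_trans[OF norm_triangle_ineq]) (simp add: norm_scaleC)
    also have "\<dots> \<le> cmod (1/z - 1/w) * (C * b) + cmod (z - w) * (C' * b)"
      by (intro add_mono mult_left_mono n) simp_all
    finally have "norm (B w (R z y - R w y)) / c \<le> g z"
      unfolding g_def using c by (intro divide_right_mono) auto
    then show ?thesis
      using bordered_bounded_below[OF w, of "R z y - R w y"] by simp
  qed
  have "w \<noteq> 0" using w S by auto
  then have "(g \<longlongrightarrow> (cmod (1/w - 1/w) * (C * b) + cmod (w - w) * (C' * b)) / c) (at w within S)"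
    unfolding g_def using c by (intro tendsto_intros) auto
  then have g0: "(g \<longlongrightarrow> 0) (at w within S)" by simp
  have "((\<lambda>z. R z y - R w y) \<longlongrightarrow> 0) (at w within S)"
    by (rule Lim_null_comparison[OF _ g0]) (simp add: eventually_at_filter bound)
  then show "((\<lambda>z. R z y) \<longlongrightarrow> R w y) (at w within S)"
    by (rule LIM_zero_cancel)
qed

text \<open>By the resolvent identity \<open>R(z) - R(w) = R(w) (B(w) - B(z)) R(z)\<close>, where \<open>B(w) - B(z)\<close> has an explicit
  factor \<open>z - w\<close>. The outer factor \<open>R(w)\<close> is moved to the other side of the inner product by
  solving the adjoint equation.\<close>
lemma solution_holomorphic: "(\<lambda>z. cinner (R z y) v) holomorphic_on S"
  unfolding holomorphic_on_def
proof
  fix w assume w: "w \<in> S"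
  obtain Bw' where Bw': "bounded_clinear Bw'" "is_cadjoint (B w) Bw'"
    using cadjoint_exists[OF bordered_clinear] by blast
  have "c * (norm x)\<^sup>2 \<le> inner (Bw' x) x" for x
    using coercive[OF w, of x] Bw'(2) inner_commute[of x "Bw' x"]
    by (simp add: is_cadjoint_def inner_eq_Re_cinner)
  then obtain v' where v': "Bw' v' = v"
    using Lax_Milgram[OF Bw'(1) c] by blast
  define g where "g z = (1/2) * (- (1 / (z * w)) * cinner (A (R z y)) v' + cinner (A' (R z y)) v')" for z
  have w0: "w \<noteq> 0" using w S by auto
  have quot: "(cinner (R z y) v - cinner (R w y) v) / (z - w) = g z" if z: "z \<in> S" "z \<noteq> w" for z
  proof -
    have z0: "z \<noteq> 0" using z S by auto
    have "cinner (R z y) v - cinner (R w y) v = cinner (B w (R z y - R w y)) v'"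
      using Bw'(2) v' by (simp add: is_cadjoint_def cinner.diff_left)
    also have "B w (R z y - R w y) = B w (R z y) - B z (R z y)"
      by (simp add: bounded_clinear_diff[OF bordered_clinear] bordered_solution z w)
    also have "cinner \<dots> v' = (z - w) * g z"
      unfolding bordered_diff using z0 w0
      by (simp add: cinner_simps g_def field_simps)
    finally show ?thesis using z by simp
  qed
  have "(g \<longlongrightarrow> g w) (at w within S)"
    unfolding g_def using w0 solution_continuous[of y] w
    by (intro tendsto_intros cinner.tendsto
        bounded_linear.tendsto[OF bounded_clinear_bounded_linear[OF A(1)]]
        bounded_linear.tendsto[OF bounded_clinear_bounded_linear[OF A(2)]])
      (auto simp: continuous_on_def)
  then have "((\<lambda>z. (cinner (R z y) v - cinner (R w y) v) / (z - w)) \<longlongrightarrow> g w) (at w within S)"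
    by (rule Lim_transform_eventually) (simp add: eventually_at_filter quot)
  then show "(\<lambda>z. cinner (R z y) v) field_differentiable at w within S"
    by (auto simp: field_differentiable_def has_field_derivative_iff)
qed

lemma bordered_combination: "z \<in> S \<Longrightarrow> B z (\<Sum>j<k. v j *\<^sub>C R z (e j)) = (\<Sum>j<k. v j *\<^sub>C e j)"
  using bounded_clinear_bounded_linear[OF bordered_clinear, THEN bounded_linear.linear]
  by (simp add: linear_sum bounded_clinear_scaleC[OF bordered_clinear] bordered_solution)

text \<open>A kernel vector \<open>x\<close> of the pencil is recovered from its coordinates \<open>\<langle>x, e\<^sub>j\<rangle>\<close>, because \<open>B(z) x\<close> is the
  combination of the \<open>e\<^sub>j\<close> with these coefficients.\<close>
lemma pencil_kernel_iff_fixed_vector: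
  assumes z: "z \<in> S"
  shows "(\<exists>x. x \<noteq> 0 \<and> numrange_pencil A A' z x = 0) \<longleftrightarrow>
    (\<exists>v. (\<exists>i<k. v i \<noteq> 0) \<and> (\<forall>i<k. (\<Sum>j<k. cinner (R z (e j)) (e i) * v j) = v i))"
proof
  assume "\<exists>x. x \<noteq> 0 \<and> numrange_pencil A A' z x = 0"
  then obtain x where x: "x \<noteq> 0" "numrange_pencil A A' z x = 0" by blast
  define v where "v j = cinner x (e j)" for j
  have "B z x = B z (\<Sum>j<k. v j *\<^sub>C R z (e j))"
    by (simp add: bordered_combination[OF z]) (simp add: B_def x(2) v_def)
  then have x_eq: "x = (\<Sum>j<k. v j *\<^sub>C R z (e j))"
    using solution_bordered[OF z] by metis
  have "(\<Sum>j<k. cinner (R z (e j)) (e i) * v j) = v i" for i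
    unfolding v_def[of i] by (subst x_eq) (simp add: cinner_simps mult.commute)
  moreover have "\<exists>i<k. v i \<noteq> 0"
    using x(1) x_eq by (metis (no_types, lifting) lessThan_iff scaleC.zero_left sum.neutral)
  ultimately show "\<exists>v. (\<exists>i<k. v i \<noteq> 0) \<and> (\<forall>i<k. (\<Sum>j<k. cinner (R z (e j)) (e i) * v j) = v i)"
    by blast
next
  assume "\<exists>v. (\<exists>i<k. v i \<noteq> 0) \<and> (\<forall>i<k. (\<Sum>j<k. cinner (R z (e j)) (e i) * v j) = v i)"
  then obtain v i where v: "i < k" "v i \<noteq> 0"
    "\<And>i. i < k \<Longrightarrow> (\<Sum>j<k. cinner (R z (e j)) (e i) * v j) = v i" by blast
  define x where "x = (\<Sum>j<k. v j *\<^sub>C R z (e j))"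
  have xv: "cinner x (e i) = v i" if "i < k" for i
    using v(3)[OF that] by (simp add: x_def cinner_simps mult.commute)
  then have "B z x = numrange_pencil A A' z x + (\<Sum>j<k. v j *\<^sub>C e j)"
    by (simp add: B_def)
  then have "numrange_pencil A A' z x = 0"
    using bordered_combination[OF z, of v] by (simp add: x_def)
  moreover have "x \<noteq> 0"
    using xv[OF v(1)] v(2) by (auto simp: cinner.zero_left)
  ultimately show "\<exists>x. x \<noteq> 0 \<and> numrange_pencil A A' z x = 0" by blast
qed

lemma pencil_kernel_continuation:
  assumes "open S" "connected S" "\<xi> \<in> S" "\<xi> islimpt U" "U \<subseteq> S"
    and "\<And>z. z \<in> U \<Longrightarrow> \<exists>x. x \<noteq> 0 \<and> numrange_pencil A A' z x = 0"
    and "w \<in> S"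
  shows "\<exists>x. x \<noteq> 0 \<and> numrange_pencil A A' w x = 0"
  unfolding pencil_kernel_iff_fixed_vector[OF \<open>w \<in> S\<close>]
proof (rule fixed_vectors_analytic_continuation[where S = S and U = U])
  show "\<exists>v. (\<exists>i<k. v i \<noteq> 0) \<and> (\<forall>i<k. (\<Sum>j<k. cinner (R z (e j)) (e i) * v j) = v i)" if "z \<in> U" for z
    using assms(6)[OF that] pencil_kernel_iff_fixed_vector[of z] that assms(5) by blast
qed (use assms solution_holomorphic in auto)

text \<open>Approximate kernel vectors are close to the finite-dimensional space spanned by the \<open>B(z)\<^sup>-\<^sup>1 e\<^sub>j\<close>, which is
  the source of compactness in the next lemma.\<close>
lemma combination_error:
  assumes "z \<in> S"
  shows "norm (x - (\<Sum>j<k. cinner x (e j) *\<^sub>C R z (e j))) \<le> norm (numrange_pencil A A' z x) / c"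
proof -
  have "B z (x - (\<Sum>j<k. cinner x (e j) *\<^sub>C R z (e j))) = numrange_pencil A A' z x"
    by (simp add: bounded_clinear_diff[OF bordered_clinear] bordered_combination[OF assms]) (simp add: B_def)
  then show ?thesis
    using bordered_bounded_below[OF assms] by metis
qed

lemma pencil_kernel_if_approximate_kernel:
  fixes x :: "nat \<Rightarrow> 'a"
  assumes z: "z \<in> S" and x: "\<And>n. norm (x n) = 1"
    and lim: "(\<lambda>n. numrange_pencil A A' z (x n)) \<longlonglongrightarrow> 0"
  shows "\<exists>x. x \<noteq> 0 \<and> numrange_pencil A A' z x = 0"
proof -
  define p where "p n = (\<Sum>j<k. cinner (x n) (e j) *\<^sub>C R z (e j))" for n
  define M where "M = (\<Sum>j<k. norm (e j))"
  have "cmod (cinner (x n) (e j)) \<le> M" if "j < k" for j n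
  proof -
    have "cmod (cinner (x n) (e j)) \<le> norm (e j)"
      using cinner_Cauchy_Schwarz[of "x n" "e j"] x by simp
    also have "\<dots> \<le> M"
      unfolding M_def using that by (intro member_le_sum) auto
    finally show ?thesis .
  qed
  then have p: "\<forall>n. p n \<in> {\<Sum>j<k. v j *\<^sub>C R z (e j) | v. \<forall>j<k. cmod (v j) \<le> M}"
    unfolding p_def by (intro allI CollectI exI conjI refl impI) simp
  obtain y s where s: "strict_mono s" "(p \<circ> s) \<longlonglongrightarrow> y"
    by (rule seq_compactE[OF compact_imp_seq_compact[OF compact_bounded_combinations] p])
  have "(\<lambda>n. norm (numrange_pencil A A' z (x n)) / c) \<longlonglongrightarrow> 0 / c"
    using c by (intro tendsto_intros tendsto_norm_zero lim) simp
  then have err: "(\<lambda>n. norm (numrange_pencil A A' z (x n)) / c) \<longlonglongrightarrow> 0" by simp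
  have "(\<lambda>n. x n - p n) \<longlonglongrightarrow> 0"
    by (rule Lim_null_comparison[OF _ err]) (simp add: p_def combination_error[OF z])
  from tendsto_add[OF LIMSEQ_subseq_LIMSEQ[OF this s(1)] s(2)]
  have xy: "(\<lambda>n. x (s n)) \<longlonglongrightarrow> y" by (simp add: o_def)
  have "(\<lambda>n. norm (x (s n))) \<longlonglongrightarrow> norm y"
    using xy by (rule tendsto_norm)
  then have "norm y = 1" by (simp add: x LIMSEQ_const_iff)
  moreover have "numrange_pencil A A' z y = 0"
  proof (rule LIMSEQ_unique)
    show "(\<lambda>n. numrange_pencil A A' z (x (s n))) \<longlonglongrightarrow> numrange_pencil A A' z y"
      by (rule bounded_linear.tendsto[OF bounded_clinear_bounded_linear xy])
        (rule bounded_clinear_numrange_pencil[OF A])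
    show "(\<lambda>n. numrange_pencil A A' z (x (s n))) \<longlonglongrightarrow> 0"
      using LIMSEQ_subseq_LIMSEQ[OF lim s(1)] by (simp add: o_def)
  qed
  ultimately show ?thesis by (metis norm_zero zero_neq_one)
qed

end

section \<open>The numerical range near a boundary point\<close>

text \<open>Coercivity is an open condition, since the pencil is norm continuous in \<open>z\<close>. It is needed for
  complex \<open>z\<close> off the unit circle, where the form of the pencil need not be positive.\<close>
lemma bordered_pencil_coercive_nearby:
  fixes A A' :: "'a::chilbert_space \<Rightarrow> 'a"
  assumes A: "bounded_clinear A" "bounded_clinear A'" and "z0 \<noteq> 0" "d > 0"
    and coercive: "\<And>x. d * (norm x)\<^sup>2 \<le> inner (numrange_pencil A A' z0 x + P x) x"
  shows "\<exists>r>0. 0 \<notin> ball z0 r \<and>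
    (\<forall>z\<in>ball z0 r. \<forall>x. d / 2 * (norm x)\<^sup>2 \<le> inner (numrange_pencil A A' z x + P x) x)"
proof -
  obtain C where C: "C > 0" "\<And>x. norm (A x) \<le> C * norm x"
    using bounded_clinear_bound[OF A(1)] by blast
  obtain C' where C': "C' > 0" "\<And>x. norm (A' x) \<le> C' * norm x"
    using bounded_clinear_bound[OF A(2)] by blast
  define g where "g z = cmod (1/z - 1/z0) * C + cmod (z - z0) * C'" for z
  have "(g \<longlongrightarrow> g z0) (nhds z0)"
    unfolding g_def using \<open>z0 \<noteq> 0\<close>
    by (intro tendsto_intros filterlim_ident) auto
  then have "\<forall>\<^sub>F z in nhds z0. g z < d / 2"
    by (rule order_tendstoD(2)) (use \<open>d > 0\<close> in \<open>simp add: g_def\<close>)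
  moreover have "\<forall>\<^sub>F z in nhds z0. z \<noteq> 0"
    using \<open>z0 \<noteq> 0\<close> by (rule t1_space_nhds)
  ultimately have "\<forall>\<^sub>F z in nhds z0. g z < d / 2 \<and> z \<noteq> 0"
    by (rule eventually_conj)
  then obtain r where r: "r > 0" "\<And>z. dist z z0 < r \<Longrightarrow> g z < d / 2 \<and> z \<noteq> 0"
    unfolding eventually_nhds_metric by blast
  have "d / 2 * (norm x)\<^sup>2 \<le> inner (numrange_pencil A A' z x + P x) x" if "z \<in> ball z0 r" for z x
  proof -
    define D where "D = numrange_pencil A A' z0 x - numrange_pencil A A' z x"
    have "norm D = norm ((1/z - 1/z0) *\<^sub>C A x + (z - z0) *\<^sub>C A' x) / 2"
      unfolding D_def numrange_pencil_diff by (simp add: norm_scaleC norm_divide)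
    also have "\<dots> \<le> norm ((1/z - 1/z0) *\<^sub>C A x + (z - z0) *\<^sub>C A' x)"
      by simp
    also have "\<dots> \<le> cmod (1/z - 1/z0) * norm (A x) + cmod (z - z0) * norm (A' x)"
      by (rule order_trans[OF norm_triangle_ineq]) (simp add: norm_scaleC)
    also have "\<dots> \<le> cmod (1/z - 1/z0) * (C * norm x) + cmod (z - z0) * (C' * norm x)"
      by (intro add_mono mult_left_mono C C') simp_all
    also have "\<dots> = g z * norm x"
      by (simp add: g_def algebra_simps)
    also have "\<dots> \<le> d / 2 * norm x"
      using r(2)[of z] that by (intro mult_right_mono) (auto simp: dist_commute)
    finally have "norm D * norm x \<le> d / 2 * norm x * norm x"
      by (intro mult_right_mono) auto
    then have "inner D x \<le> d / 2 * (norm x)\<^sup>2"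
      using norm_cauchy_schwarz[of D x] by (simp add: power2_eq_square mult.assoc)
    moreover have "inner (numrange_pencil A A' z0 x + P x) x =
        inner D x + inner (numrange_pencil A A' z x + P x) x"
      by (simp add: D_def inner_simps)
    ultimately show ?thesis using coercive[of x] by simp
  qed
  moreover have "0 \<notin> ball z0 r" using r(2)[of 0] by (auto simp: dist_commute)
  ultimately show ?thesis using r(1) by blast
qed

lemma numerical_range_form_bound:
  assumes A: "bounded_clinear A" and W: "numerical_range A \<subseteq> cball 0 1"
  shows "cmod (cinner (A x) x) \<le> (norm x)\<^sup>2"
proof (cases "x = 0")
  case False
  define u where "u = complex_of_real (1 / norm x) *\<^sub>C x"
  have u: "norm u = 1" "x = complex_of_real (norm x) *\<^sub>C u"
    using False by (simp_all add: u_def norm_scaleC norm_divide scaleC_scaleC scaleC_one)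
  have "cinner (A u) u \<in> numerical_range A"
    using u(1) by (auto simp: numerical_range_def)
  then have "cmod (cinner (A u) u) \<le> 1" using W by auto
  moreover have "cinner (A x) x = complex_of_real ((norm x)\<^sup>2) * cinner (A u) u"
    by (subst (1 2) u(2)) (simp add: bounded_clinear_scaleC[OF A] cinner_simps power2_eq_square)
  ultimately show ?thesis
    by (simp add: norm_mult norm_power mult_left_le)
qed (simp add: cinner.zero_right)

text \<open>Both claims come from the bordered pencil at \<open>z0\<close>: the first from compactness of bounded sets in the
  finite-dimensional space it singles out, the second from continuation of the kernel.\<close>
lemma numerical_range_near_boundary_point:
  fixes A N K :: "'a::chilbert_space \<Rightarrow> 'a"
  assumes N: "normal_operator N" and K: "compact_operator K" and A: "A = (\<lambda>x. N x + K x)"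
    and W: "numerical_range A \<subseteq> cball 0 1"
    and z0: "z0 \<in> sphere 0 1" "z0 \<notin> essential_spectrum A"
  shows "z0 \<in> closure (numerical_range A) \<Longrightarrow> z0 \<in> numerical_range A"
    and "z0 islimpt (sphere 0 1 \<inter> numerical_range A) \<Longrightarrow>
      \<exists>r>0. sphere 0 1 \<inter> ball z0 r \<subseteq> numerical_range A"
proof -
  have cA: "bounded_clinear A"
    unfolding A using N K
    by (intro bounded_clinear_plus) (simp_all add: normal_operator_def compact_operator_def)
  obtain A' where A': "bounded_clinear A'" "is_cadjoint A A'"
    using cadjoint_exists[OF cA] by blast
  note bound = numerical_range_form_bound[OF cA W]
  have z0n: "cmod z0 = 1" using z0(1) by simp
  obtain E d where Ed: "finite E" "d > 0" "\<And>x. norm x = 1 \<Longrightarrow>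
      d \<le> 1 - Re (cnj z0 * cinner (A x) x) + (\<Sum>e\<in>E. (cmod (cinner x e))\<^sup>2)"
    using coercive_modulo_finite_rank[OF N K A bound z0n z0(2)] by blast
  obtain e where e: "bij_betw e {0..<card E} E"
    using ex_bij_betw_nat_finite[OF Ed(1)] by blast
  define P where "P x = (\<Sum>j<card E. cinner x (e j) *\<^sub>C e j)" for x
  have form: "inner (numrange_pencil A A' z0 x + P x) x =
      (norm x)\<^sup>2 - Re (cnj z0 * cinner (A x) x) + (\<Sum>e\<in>E. (cmod (cinner x e))\<^sup>2)" for x
  proof -
    have "inner (P x) x = (\<Sum>j<card E. (cmod (cinner x (e j)))\<^sup>2)"
      unfolding P_def inner_sum_left
    proof (rule sum.cong)
      fix j
      have "cinner x (e j) * cinner (e j) x = complex_of_real ((cmod (cinner x (e j)))\<^sup>2)"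
        by (metis cinner_commute complex_norm_square)
      then show "inner (cinner x (e j) *\<^sub>C e j) x = (cmod (cinner x (e j)))\<^sup>2"
        by (simp add: inner_eq_Re_cinner cinner_scaleC_left)
    qed simp
    also have "\<dots> = (\<Sum>e\<in>E. (cmod (cinner x e))\<^sup>2)"
      using sum.reindex_bij_betw[OF e, of "\<lambda>e. (cmod (cinner x e))\<^sup>2"] by (simp add: atLeast0LessThan)
    finally show ?thesis
      by (simp add: inner_add_left numrange_pencil_form[OF A'(2) z0n])
  qed
  have coercive: "d * (norm x)\<^sup>2 \<le> inner (numrange_pencil A A' z0 x + P x) x" for x
  proof (cases "x = 0")
    case False
    define u where "u = complex_of_real (1 / norm x) *\<^sub>C x"
    define t where "t = norm x"
    have u: "norm u = 1" "x = complex_of_real t *\<^sub>C u"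
      using False by (simp_all add: u_def t_def norm_scaleC norm_divide scaleC_scaleC scaleC_one)
    have "t \<ge> 0" by (simp add: t_def)
    then have "inner (numrange_pencil A A' z0 x + P x) x =
        t\<^sup>2 * (1 - Re (cnj z0 * cinner (A u) u) + (\<Sum>e\<in>E. (cmod (cinner u e))\<^sup>2))"
      unfolding form unfolding u(2)
      by (simp add: bounded_clinear_scaleC[OF cA] cinner_simps norm_scaleC u(1) norm_mult
          power_mult_distrib sum_distrib_left distrib_left right_diff_distrib power2_eq_square mult_ac)
    moreover have "t\<^sup>2 * d \<le> t\<^sup>2 * (1 - Re (cnj z0 * cinner (A u) u) + (\<Sum>e\<in>E. (cmod (cinner u e))\<^sup>2))"
      by (intro mult_left_mono Ed(3) u(1)) simp
    ultimately show ?thesis by (simp add: t_def mult.commute)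
  qed (simp add: P_def)
  have "z0 \<noteq> 0" using z0n by auto
  then obtain r where r: "r > 0" "0 \<notin> ball z0 r"
    "\<And>z x. z \<in> ball z0 r \<Longrightarrow> d / 2 * (norm x)\<^sup>2 \<le>
      inner (numrange_pencil A A' z x + (\<Sum>j<card E. cinner x (e j) *\<^sub>C e j)) x"
    using bordered_pencil_coercive_nearby[OF cA A'(1) _ Ed(2) coercive] unfolding P_def by blast
  have d2: "d / 2 > 0" using Ed(2) by simp
  note mem_iff = numerical_range_boundary_iff[OF cA A' bound]
  show "z0 \<in> numerical_range A" if cl: "z0 \<in> closure (numerical_range A)"
  proof -
    obtain w where w: "\<And>n. w n \<in> numerical_range A" "w \<longlonglongrightarrow> z0"
      using cl unfolding closure_sequential by blast
    then have "\<forall>n. \<exists>x. norm x = 1 \<and> w n = cinner (A x) x"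
      by (auto simp: numerical_range_def)
    then obtain x where x: "\<And>n. norm (x n) = 1" "\<And>n. w n = cinner (A (x n)) (x n)"
      by metis
    obtain C where C: "\<And>x. (norm (numrange_pencil A A' z0 x))\<^sup>2 \<le>
        C * ((norm x)\<^sup>2 - Re (cnj z0 * cinner (A x) x))"
      using pencil_norm_bound[OF cA A' bound z0n] by blast
    have "(\<lambda>n. C * (1 - Re (cnj z0 * w n))) \<longlonglongrightarrow> C * (1 - Re (cnj z0 * z0))"
      by (intro tendsto_intros w)
    moreover have "cnj z0 * z0 = 1"
      using z0n by (simp add: mult.commute flip: complex_norm_square)
    ultimately have "(\<lambda>n. C * (1 - Re (cnj z0 * w n))) \<longlonglongrightarrow> 0" by simp
    then have lim: "(\<lambda>n. numrange_pencil A A' z0 (x n)) \<longlonglongrightarrow> 0"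
    proof (rule tendsto_zero_power2_bound)
      show "(norm (numrange_pencil A A' z0 (x n)))\<^sup>2 \<le> C * (1 - Re (cnj z0 * w n))" for n
        using C[of "x n"] by (simp only: x power_one)
    qed
    have "\<exists>x. x \<noteq> 0 \<and> numrange_pencil A A' z0 x = 0"
    proof (rule pencil_kernel_if_approximate_kernel[where x = x, OF cA A'(1) d2 r(2,3)])
      show "z0 \<in> ball z0 r" using r(1) by simp
      show "norm (x n) = 1" for n by (rule x(1))
    qed (use lim in auto)
    then show ?thesis by (simp add: mem_iff z0n)
  qed
  show "\<exists>r>0. sphere 0 1 \<inter> ball z0 r \<subseteq> numerical_range A"
    if lim: "z0 islimpt (sphere 0 1 \<inter> numerical_range A)"
  proof (intro exI conjI subsetI)
    fix z assume z: "z \<in> sphere 0 1 \<inter> ball z0 r"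
    have "\<exists>x. x \<noteq> 0 \<and> numrange_pencil A A' z x = 0"
    proof (rule pencil_kernel_continuation[OF cA A'(1) d2 r(2,3)])
      show "z0 islimpt sphere 0 1 \<inter> numerical_range A \<inter> ball z0 r"
        by (rule islimpt_Int_eventually[OF lim eventually_at_in_open']) (simp_all add: r(1))
      show "\<exists>x. x \<noteq> 0 \<and> numrange_pencil A A' w x = 0"
        if "w \<in> sphere 0 1 \<inter> numerical_range A \<inter> ball z0 r" for w
        using that mem_iff[of w] by simp
    qed (use z r(1) in auto)
    then show "z \<in> numerical_range A"
      using z by (simp add: mem_iff)
  qed (rule r(1))
qed

text \<open>In a component \<open>C\<close> of \<open>\<Gamma>\<close>, the limit points of \<open>C \<inter> numerical_range A\<close> form an open set because the
  numerical range contains a whole arc around each of them, and a closed set trivially.\<close>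
theorem theorem3:
  fixes A N K :: "'a::chilbert_space \<Rightarrow> 'a" and \<Gamma> :: "complex set"
  assumes "normal_operator N" and "compact_operator K"
    and "A = (\<lambda>x. N x + K x)"
    and "numerical_range A \<subseteq> cball 0 1"
    and "openin (top_of_set (sphere 0 1)) \<Gamma>"
    and "\<Gamma> \<inter> essential_spectrum A = {}"
    and "\<And>C. C \<in> components \<Gamma> \<Longrightarrow> \<exists>z\<in>C. z islimpt (C \<inter> closure (numerical_range A))"
  shows "\<Gamma> \<subseteq> numerical_range A"
proof -
  note near = numerical_range_near_boundary_point[OF assms(1-4)]
  have \<Gamma>: "\<Gamma> \<subseteq> sphere 0 1" "\<And>z. z \<in> \<Gamma> \<Longrightarrow> z \<notin> essential_spectrum A"
    using assms(5,6) by (auto dest: openin_imp_subset)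
  have closure_W: "z \<in> numerical_range A" if "z \<in> \<Gamma>" "z \<in> closure (numerical_range A)" for z
    using near(1)[of z] that \<Gamma> by blast
  have "C \<subseteq> numerical_range A" if C: "C \<in> components \<Gamma>" for C
  proof -
    have C\<Gamma>: "C \<subseteq> \<Gamma>" using C by (rule in_components_subset)
    have "locally connected \<Gamma>"
      using locally_open_subset[OF locally_connected_sphere assms(5)] .
    then have C_open: "openin (top_of_set (sphere 0 1)) C"
      using openin_components_locally_connected[OF _ C] openin_trans assms(5) by blast
    define L where "L = {z \<in> C. z islimpt (C \<inter> numerical_range A)}"
    have "openin (top_of_set C) L"
      unfolding openin_euclidean_subtopology_iff
    proof (intro conjI ballI)
      fix z assume "z \<in> L"
      then have z: "z \<in> C" "z islimpt (C \<inter> numerical_range A)" by (auto simp: L_def)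
      then have "z islimpt (sphere 0 1 \<inter> numerical_range A)"
        using C\<Gamma> \<Gamma>(1) by (blast intro: islimpt_subset)
      then obtain r where r: "r > 0" "sphere 0 1 \<inter> ball z r \<subseteq> numerical_range A"
        using near(2)[of z] z(1) C\<Gamma> \<Gamma> by blast
      have "w \<in> L" if w: "w \<in> C" "dist w z < r" for w
      proof -
        have "\<exists>T. open T \<and> C = sphere 0 1 \<inter> T"
          using C_open by (auto simp: openin_open)
        then obtain T where T: "open T" "C = sphere 0 1 \<inter> T" by blast
        have "w islimpt sphere 0 1"
        proof (rule connected_imp_perfect)
          show "connected (sphere 0 1 :: complex set)"
            by (rule connected_sphere) simp
          show "sphere 0 1 \<noteq> {x}" for x :: complex
          proof
            assume "sphere 0 1 = {x}"
            then have "1 \<in> {x}" "- 1 \<in> {x}" by (metis mem_sphere_0 norm_one norm_minus_cancel)+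
            then show False by simp
          qed
        qed (use w C\<Gamma> \<Gamma>(1) in blast)
        then have "w islimpt sphere 0 1 \<inter> (T \<inter> ball z r)"
          by (rule islimpt_Int_eventually[OF _ eventually_at_in_open'])
            (use w T in \<open>auto simp: dist_commute\<close>)
        moreover have "sphere 0 1 \<inter> (T \<inter> ball z r) \<subseteq> C \<inter> numerical_range A"
          using T(2) r(2) by blast
        ultimately show ?thesis
          using w(1) by (auto simp: L_def intro: islimpt_subset)
      qed
      then show "\<exists>e>0. \<forall>x'\<in>C. dist x' z < e \<longrightarrow> x' \<in> L" using r(1) by blast
    qed (auto simp: L_def)
    moreover have "closedin (top_of_set C) L"
    proof -
      have "L = C \<inter> {z. z islimpt (C \<inter> numerical_range A)}" by (auto simp: L_def)
      then show ?thesis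
        using closed_limpts by (metis closedin_closed_Int)
    qed
    moreover have "L \<noteq> {}"
    proof -
      obtain z where z: "z \<in> C" "z islimpt (C \<inter> closure (numerical_range A))"
        using assms(7)[OF C] by blast
      moreover have "C \<inter> closure (numerical_range A) \<subseteq> C \<inter> numerical_range A"
        using closure_W C\<Gamma> by blast
      ultimately have "z \<in> L" unfolding L_def using islimpt_subset by blast
      then show ?thesis by blast
    qed
    ultimately have "L = C"
      using in_components_connected[OF C] unfolding connected_clopen by blast
    show ?thesis
    proof
      fix z assume "z \<in> C"
      then have "z islimpt (C \<inter> numerical_range A)" using \<open>L = C\<close> by (auto simp: L_def)
      then have "z \<in> closure (numerical_range A)"
        using islimpt_subset[OF _ Int_lower2] by (auto simp: closure_def)
      then show "z \<in> numerical_range A" using closure_W \<open>z \<in> C\<close> C\<Gamma> by blast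
    qed
  qed
  then show ?thesis
    using Union_components[of \<Gamma>] by blast
qed

end
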